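(* Let $(W,S)$ be a finite Coxeter system, let $Q = q_1 q_2\cdots q_m$ be a word on $S$, and let $\rho\in W$ be such that $Q$ contains a reduced expression of $\rho$ as a subword. The negative greedy flip tree $\mathcal{N}(Q,\rho)$ is a spanning tree of the increasing flip graph $\mathcal{G}(Q,\rho)$, oriented towards its root $\mathsf{N}(Q,\rho)$. The positive greedy flip tree $\mathcal{P}(Q,\rho)$ is a spanning tree of the increasing flip graph $\mathcal{G}(Q,\rho)$, oriented from its root $\mathsf{P}(Q,\rho)$.
   Context: Let $(W,S)$ be a finite Coxeter system, with length function $\ell$ and identity $e$; let $\varepsilon$ denote the empty word. For a word $Q=q_1\cdots q_m$ on $S$ and $\rho\in W$, write $\rho\prec Q$ if $Q$ contains a reduced expression of $\rho$ as a (not necessarily consecutive) subword. The subword complex $\mathcal{SC}(Q,\rho)$ is the simplicial complex on the set of positions $[m]=\{1,\dots,m\}$ whose faces are the sets of positions whose complement contains a reduced expression of $\rho$; its facets are the complements of the sets of positions forming a reduced expression of $\rho$ in $Q$. It is non-empty iff $\rho\prec Q$. Let $\mathcal{F}(Q,\rho)$ be its set of facets. Flips. Two distinct facets $I,J$ are adjacent if $I\smallsetminus i=J\smallsetminus j$ for some $i\in I$, $j\in J$; then $J$ is obtained from $I$ by flipping $i$, and this flip from $I$ to $J$ is increasing if $i<j$. The increasing flip graph $\mathcal{G}(Q,\rho)$ is the directed graph with vertex set $\mathcal{F}(Q,\rho)$ and an arc $I\to J$ for each increasing flip from $I$ to $J$. Greedy facets. The positive greedy facet $\mathsf{P}(Q,\rho)$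 is the unique source of $\mathcal{G}(Q,\rho)$, which is the lexicographically smallest facet; the negative greedy facet $\mathsf{N}(Q,\rho)$ is the unique sink of $\mathcal{G}(Q,\rho)$, which is the lexicographically largest facet (facets being compared as increasing sequences of positions). Notation. $Q_{\vdash}=q_2\cdots q_m$ and $Q_{\dashv}=q_1\cdots q_{m-1}$. For a set $X\subset\mathbb{Z}$, $X^{\rightarrow}=\{x+1 : x\in X\}$. For a tree $T$ whose vertices are subsets of $\mathbb{Z}$, $T^{\rightarrow}$ is obtained by replacing each vertex $X$ by $X^{\rightarrow}$, and $T\star z=z\star T$ by replacing each vertex $X$ by $X\cup\{z\}$. The negative greedy flip tree $\mathcal{N}(Q,\rho)$ is the directed graph defined inductively as follows. $\mathcal{N}(\varepsilon,e)$ has the single vertex $\emptyset$. For non-empty $Q$, $\mathcal{N}(Q,\rho)$ is: (i) $\mathcal{N}(Q_{\dashv},\rho q_m)$ if $m$ appears in none of the facets of $\mathcal{SC}(Q,\rho)$; (ii) $\mathcal{N}(Q_{\dashv},\rho)\star m$ if $m$ appears in all the facets of $\mathcal{SC}(Q,\rho)$; (iii) otherwise, the disjoint union of $\mathcal{N}(Q_{\dashv},\rho q_m)$ and $\mathcal{N}(Q_{\dashv},\rho)\star m$, with an additional arc from $\mathsf{N}(Q_{\dashv},\rho q_m)$ to $\mathsf{N}(Q,\rho)=\mathsf{N}(Q_{\dashv},\rho)\cup\{m\}$. The positive greedy flip tree $\mathcal{P}(Q,\rho)$ is the directed graph defined inductively as follows. $\mathcal{P}(\varepsilon,e)$ has the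 single vertex $\emptyset$. For non-empty $Q$, $\mathcal{P}(Q,\rho)$ is: (i) $\mathcal{P}(Q_{\vdash},q_1\rho)^{\rightarrow}$ if $1$ appears in none of the facets of $\mathcal{SC}(Q,\rho)$; (ii) $1\star\mathcal{P}(Q_{\vdash},\rho)^{\rightarrow}$ if $1$ appears in all the facets of $\mathcal{SC}(Q,\rho)$; (iii) otherwise, the disjoint union of $\mathcal{P}(Q_{\vdash},q_1\rho)^{\rightarrow}$ and $1\star\mathcal{P}(Q_{\vdash},\rho)^{\rightarrow}$, with an additional arc from $\mathsf{P}(Q,\rho)=\{1\}\cup\mathsf{P}(Q_{\vdash},\rho)^{\rightarrow}$ to $\mathsf{P}(Q_{\vdash},q_1\rho)^{\rightarrow}$. *)

theory Defs
  imports "HOL-Algebra.Algebra" "HOL-Library.Sublist" "Graph_Theory.Graph_Theory"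
begin

section \<open>Coxeter systems\<close>

text \<open>
  Equality of words in the group presented by generators \<open>A\<close> and relators \<open>R\<close>.
  A letter \<open>(x, True)\<close> stands for \<open>x\<close> and \<open>(x, False)\<close> for its formal inverse.
\<close>

inductive presentation_eq ::
  "'a set \<Rightarrow> ('a \<times> bool) list set \<Rightarrow> ('a \<times> bool) list \<Rightarrow> ('a \<times> bool) list \<Rightarrow> bool"
  for A R where
  refl: "presentation_eq A R u u"
| sym: "presentation_eq A R u v \<Longrightarrow> presentation_eq A R v u"
| trans: "presentation_eq A R u v \<Longrightarrow> presentation_eq A R v w \<Longrightarrow> presentation_eq A R u w"
| cancel: "x \<in> A \<Longrightarrow> presentation_eq A R (u @ [(x, b), (x, \<not> b)] @ v) (u @ v)"
| relator: "r \<in> R \<Longrightarrow> presentation_eq A R (u @ r @ v) (u @ v)"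

definition signed_word_prod :: "('a, 'b) monoid_scheme \<Rightarrow> ('a \<times> bool) list \<Rightarrow> 'a" where
  "signed_word_prod W u =
     foldr (\<lambda>(x, b) g. (if b then x else inv\<^bsub>W\<^esub> x) \<otimes>\<^bsub>W\<^esub> g) u \<one>\<^bsub>W\<^esub>"

text \<open>
  \<open>m(s,t)\<close> is the order of \<open>s t\<close>. As \<open>group.ord\<close> is \<open>0\<close> on elements of infinite
  order, the relator of such a pair is the empty word, that is, there is no relation.
\<close>

definition coxeter_relators :: "('a, 'b) monoid_scheme \<Rightarrow> 'a set \<Rightarrow> ('a \<times> bool) list set" where
  "coxeter_relators W S =
     {concat (replicate (group.ord W (s \<otimes>\<^bsub>W\<^esub> t)) [(s, True), (t, True)]) | s t. s \<in> S \<and> t \<in> S}"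

locale coxeter_system = group W for W :: "('a, 'b) monoid_scheme" (structure) +
  fixes S :: "'a set"
  assumes generators_in_carrier: "S \<subseteq> carrier W"
    and generators_generate: "generate W S = carrier W"
    and generators_order: "s \<in> S \<Longrightarrow> ord s = 2"
    and presentation: "u \<in> lists (S \<times> UNIV) \<Longrightarrow>
      signed_word_prod W u = \<one> \<longleftrightarrow> presentation_eq S (coxeter_relators W S) u []"

definition word_prod :: "('a, 'b) monoid_scheme \<Rightarrow> 'a list \<Rightarrow> 'a" where
  "word_prod W u = foldr (\<otimes>\<^bsub>W\<^esub>) u \<one>\<^bsub>W\<^esub>"

definition coxeter_length :: "('a, 'b) monoid_scheme \<Rightarrow> 'a set \<Rightarrow> 'a \<Rightarrow> nat" where
  "coxeter_length W S w = (LEAST n. \<exists>u \<in> lists S. word_prod W u = w \<and> length u = n)"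

definition reduced_expression :: "('a, 'b) monoid_scheme \<Rightarrow> 'a set \<Rightarrow> 'a list \<Rightarrow> 'a \<Rightarrow> bool" where
  "reduced_expression W S u w \<longleftrightarrow>
     u \<in> lists S \<and> word_prod W u = w \<and> length u = coxeter_length W S w"

text \<open>\<open>contains_reduced W S Q \<rho>\<close> is the relation \<open>\<rho> \<prec> Q\<close>.\<close>

definition contains_reduced :: "('a, 'b) monoid_scheme \<Rightarrow> 'a set \<Rightarrow> 'a list \<Rightarrow> 'a \<Rightarrow> bool" where
  "contains_reduced W S Q \<rho> \<longleftrightarrow> (\<exists>u. subseq u Q \<and> reduced_expression W S u \<rho>)"


section \<open>Subword complexes and flips\<close>

text \<open>Positions in a word are numbered from 1, whereas \<open>nths\<close> counts from 0.\<close>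

definition positions :: "'a list \<Rightarrow> nat set" where
  "positions Q = {1..length Q}"

definition subword :: "'a list \<Rightarrow> nat set \<Rightarrow> 'a list" where
  "subword Q A = nths Q {i. Suc i \<in> A}"

definition subword_complex ::
  "('a, 'b) monoid_scheme \<Rightarrow> 'a set \<Rightarrow> 'a list \<Rightarrow> 'a \<Rightarrow> nat set set" where
  "subword_complex W S Q \<rho> =
     {F. F \<subseteq> positions Q \<and> contains_reduced W S (subword Q (positions Q - F)) \<rho>}"

definition facets :: "('a, 'b) monoid_scheme \<Rightarrow> 'a set \<Rightarrow> 'a list \<Rightarrow> 'a \<Rightarrow> nat set set" where
  "facets W S Q \<rho> =
     {F \<in> subword_complex W S Q \<rho>. \<forall>G \<in> subword_complex W S Q \<rho>. F \<subseteq> G \<longrightarrow> F = G}"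

definition increasing_flip :: "nat set \<Rightarrow> nat set \<Rightarrow> bool" where
  "increasing_flip I J \<longleftrightarrow> I \<noteq> J \<and> (\<exists>i \<in> I. \<exists>j \<in> J. I - {i} = J - {j} \<and> i < j)"

definition flip_graph ::
  "('a, 'b) monoid_scheme \<Rightarrow> 'a set \<Rightarrow> 'a list \<Rightarrow> 'a \<Rightarrow> nat set pair_pre_digraph" where
  "flip_graph W S Q \<rho> =
     \<lparr>pverts = facets W S Q \<rho>,
      parcs = {(I, J). I \<in> facets W S Q \<rho> \<and> J \<in> facets W S Q \<rho> \<and> increasing_flip I J}\<rparr>"

definition positive_greedy_facet ::
  "('a, 'b) monoid_scheme \<Rightarrow> 'a set \<Rightarrow> 'a list \<Rightarrow> 'a \<Rightarrow> nat set" where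
  "positive_greedy_facet W S Q \<rho> =
     (THE I. I \<in> facets W S Q \<rho> \<and> in_arcs (flip_graph W S Q \<rho>) I = {})"

definition negative_greedy_facet ::
  "('a, 'b) monoid_scheme \<Rightarrow> 'a set \<Rightarrow> 'a list \<Rightarrow> 'a \<Rightarrow> nat set" where
  "negative_greedy_facet W S Q \<rho> =
     (THE I. I \<in> facets W S Q \<rho> \<and> out_arcs (flip_graph W S Q \<rho>) I = {})"


section \<open>Greedy flip trees\<close>

definition map_digraph :: "('c \<Rightarrow> 'd) \<Rightarrow> 'c pair_pre_digraph \<Rightarrow> 'd pair_pre_digraph" where
  "map_digraph f T = \<lparr>pverts = f ` pverts T, parcs = map_prod f f ` parcs T\<rparr>"

abbreviation shift_tree :: "nat set pair_pre_digraph \<Rightarrow> nat set pair_pre_digraph" where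
  "shift_tree \<equiv> map_digraph (image Suc)"

abbreviation star_tree :: "nat \<Rightarrow> nat set pair_pre_digraph \<Rightarrow> nat set pair_pre_digraph" where
  "star_tree z \<equiv> map_digraph (insert z)"

definition join_digraphs ::
  "'c pair_pre_digraph \<Rightarrow> 'c pair_pre_digraph \<Rightarrow> 'c \<times> 'c \<Rightarrow> 'c pair_pre_digraph" where
  "join_digraphs T T' a =
     \<lparr>pverts = pverts T \<union> pverts T', parcs = insert a (parcs T \<union> parcs T')\<rparr>"

text \<open>
  On the empty word only the tree for \<open>\<rho> = e\<close> is prescribed; the value for \<open>\<rho> \<noteq> e\<close> is
  arbitrary, and is never used when starting from some \<open>\<rho> \<prec> Q\<close>.
\<close>

definition base_tree :: "('a, 'b) monoid_scheme \<Rightarrow> 'a \<Rightarrow> nat set pair_pre_digraph" where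
  "base_tree W \<rho> = \<lparr>pverts = (if \<rho> = \<one>\<^bsub>W\<^esub> then {{}} else {}), parcs = {}\<rparr>"

text \<open>
  In the last case of the following two definitions, the union is disjoint: the position
  \<open>m\<close>, respectively \<open>1\<close>, lies in all vertices of one of the two trees and in none of the
  other.
\<close>

function negative_greedy_tree ::
  "('a, 'b) monoid_scheme \<Rightarrow> 'a set \<Rightarrow> 'a list \<Rightarrow> 'a \<Rightarrow> nat set pair_pre_digraph" where
  "negative_greedy_tree W S [] \<rho> = base_tree W \<rho>"
| "negative_greedy_tree W S (Q @ [q]) \<rho> =
     (let m = length (Q @ [q]); F = facets W S (Q @ [q]) \<rho> in
      if \<forall>I \<in> F. m \<notin> I then negative_greedy_tree W S Q (\<rho> \<otimes>\<^bsub>W\<^esub> q)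
      else if \<forall>I \<in> F. m \<in> I then star_tree m (negative_greedy_tree W S Q \<rho>)
      else join_digraphs
             (negative_greedy_tree W S Q (\<rho> \<otimes>\<^bsub>W\<^esub> q))
             (star_tree m (negative_greedy_tree W S Q \<rho>))
             (negative_greedy_facet W S Q (\<rho> \<otimes>\<^bsub>W\<^esub> q), negative_greedy_facet W S (Q @ [q]) \<rho>))"
  by (auto, metis rev_exhaust)
termination by (relation "measure (\<lambda>(W, S, Q, \<rho>). length Q)") auto

fun positive_greedy_tree ::
  "('a, 'b) monoid_scheme \<Rightarrow> 'a set \<Rightarrow> 'a list \<Rightarrow> 'a \<Rightarrow> nat set pair_pre_digraph" where
  "positive_greedy_tree W S [] \<rho> = base_tree W \<rho>"
| "positive_greedy_tree W S (q # Q) \<rho> =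
     (let F = facets W S (q # Q) \<rho> in
      if \<forall>I \<in> F. 1 \<notin> I then shift_tree (positive_greedy_tree W S Q (q \<otimes>\<^bsub>W\<^esub> \<rho>))
      else if \<forall>I \<in> F. 1 \<in> I then star_tree 1 (shift_tree (positive_greedy_tree W S Q \<rho>))
      else join_digraphs
             (shift_tree (positive_greedy_tree W S Q (q \<otimes>\<^bsub>W\<^esub> \<rho>)))
             (star_tree 1 (shift_tree (positive_greedy_tree W S Q \<rho>)))
             (positive_greedy_facet W S (q # Q) \<rho>, Suc ` positive_greedy_facet W S Q (q \<otimes>\<^bsub>W\<^esub> \<rho>)))"


section \<open>Oriented spanning trees\<close>

text \<open>
  The predicates \<open>tree\<close> and \<open>spanning_tree\<close> of \<^theory>\<open>Graph_Theory.Digraph_Component\<close> only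
  forbid directed cycles, hence accept every connected acyclic digraph. Here the underlying
  undirected graph has to be a tree. It is represented by \<open>mk_symmetric\<close>, in which every
  edge gives a closed walk of length 2 that is not an undirected cycle. Loops and pairs of
  opposite arcs are excluded separately.
\<close>

definition oriented_tree :: "'c pair_pre_digraph \<Rightarrow> bool" where
  "oriented_tree T \<longleftrightarrow>
     Digraph_Component.connected T \<and>
     (\<forall>u v. (u, v) \<in> parcs T \<longrightarrow> (v, u) \<notin> parcs T) \<and>
     \<not> (\<exists>p. pre_digraph.cycle (mk_symmetric T) p \<and> 3 \<le> length p)"

definition oriented_spanning_tree :: "'c pair_pre_digraph \<Rightarrow> 'c pair_pre_digraph \<Rightarrow> bool" where
  "oriented_spanning_tree T G \<longleftrightarrow> oriented_tree T \<and> spanning T G"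

definition oriented_towards :: "'c pair_pre_digraph \<Rightarrow> 'c \<Rightarrow> bool" where
  "oriented_towards T r \<longleftrightarrow> r \<in> pverts T \<and> (\<forall>v \<in> pverts T. v \<rightarrow>\<^sup>*\<^bsub>T\<^esub> r)"

definition oriented_from :: "'c pair_pre_digraph \<Rightarrow> 'c \<Rightarrow> bool" where
  "oriented_from T r \<longleftrightarrow> r \<in> pverts T \<and> (\<forall>v \<in> pverts T. r \<rightarrow>\<^sup>*\<^bsub>T\<^esub> v)"

end

theory Submission
  imports Defs
begin

text \<open>
  Let \<open>Q = Q' q\<close> have length \<open>m\<close>. Using or skipping the last letter splits the facets of
  \<open>SC(Q, \<rho>)\<close> into those of
  \<open>SC(Q', \<rho> q)\<close> and those of \<open>SC(Q', \<rho>)\<close> with \<open>m\<close> added, which is the recursion that defines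
  the negative greedy flip tree. So its vertices are the facets, and by induction every vertex
  except the root has exactly one outgoing arc and reaches the root. The only point at issue is
  the arc that joins the two halves: it has to be an increasing flip, and it has to start and
  end at the roots of the two halves.

  This requires a grip on the sink of the increasing flip graph. Read \<open>Q\<close> from the left and
  use a letter for \<open>\<rho>\<close> whenever it is a left descent of what remains of \<open>\<rho>\<close>; the positions
  that are skipped form the facet \<open>left_greedy Q \<rho>\<close>. A facet that skips a descent at position 1
  can be flipped there: by the exchange condition, using this letter makes some later letter
  superfluous. Hence \<open>left_greedy Q \<rho>\<close> is the unique sink (\<open>flip_sink_iff_left_greedy\<close>). Running
  the greedy algorithm simultaneously on \<open>\<sigma>\<close> and on \<open>\<sigma> q > \<sigma>\<close>, both runs make the same
  choices until the first letter that only \<open>\<sigma> q\<close> uses; by the exchange condition that letter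
  turns \<open>\<sigma> q\<close> into \<open>\<sigma>\<close>, and from then on the two runs coincide. So the two sinks differ in
  exactly one position (\<open>left_greedy_mult_right\<close>), and for \<open>\<sigma> = \<rho> q\<close> this says that the joining
  arc is an increasing flip (\<open>left_greedy_flip_last\<close>).

  The exchange condition is derived from the presentation. For a word \<open>s\<^sub>1 \<dots> s\<^sub>k\<close> consider the
  reflections \<open>s\<^sub>1 \<dots> s\<^sub>i \<dots> s\<^sub>1\<close>. How often a given reflection occurs among them is,
  modulo 2, invariant under the defining relations, so it depends on the product of the word
  only; and if \<open>t\<close> occurs, then multiplying by \<open>t\<close> amounts to deleting a letter.

  The positive tree is the negative tree of the reversed word and the inverse element, with
  positions read backwards and arcs reversed. This symmetry is used for facets and greedy facets;
  the two inductions on the trees are then parallel. Trees are handled as digraphs with out-degree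
  at most one in which everything flows to a root (\<open>in_tree\<close>); such a digraph contains no
  undirected cycle, because the deepest vertex of a cycle would have two outgoing arcs.
\<close>

section \<open>Reflections and the exchange condition\<close>

context coxeter_system
begin

lemma generator_closed: "s \<in> S \<Longrightarrow> s \<in> carrier W"
  using generators_in_carrier by blast

lemma generator_square: "s \<in> S \<Longrightarrow> s \<otimes> s = \<one>"
  using pow_ord_eq_1[of s] generator_closed[of s] generators_order[of s]
  by (simp add: numeral_2_eq_2)

lemma generator_cancel: "s \<in> S \<Longrightarrow> x \<in> carrier W \<Longrightarrow> s \<otimes> (s \<otimes> x) = x"
  by (metis generator_closed generator_square l_one m_assoc)

lemma generator_cancel_right: "s \<in> S \<Longrightarrow> x \<in> carrier W \<Longrightarrow> (x \<otimes> s) \<otimes> s = x"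
  by (metis generator_closed generator_square r_one m_assoc)

lemma generator_inv: "s \<in> S \<Longrightarrow> inv s = s"
  using generator_square generator_closed inv_equality by blast

lemma word_prod_simps [simp]:
  "word_prod W [] = \<one>" "word_prod W (s # u) = s \<otimes> word_prod W u"
  by (simp_all add: word_prod_def)

lemma word_prod_closed [simp]: "u \<in> lists S \<Longrightarrow> word_prod W u \<in> carrier W"
  by (induction u) (auto simp: generator_closed)

lemma word_prod_append:
  "u \<in> lists S \<Longrightarrow> v \<in> lists S \<Longrightarrow> word_prod W (u @ v) = word_prod W u \<otimes> word_prod W v"
  by (induction u) (auto simp: generator_closed m_assoc)

lemma word_prod_rev: "u \<in> lists S \<Longrightarrow> word_prod W (rev u) = inv (word_prod W u)"
proof (induction u)
  case (Cons s u)
  then have "s \<in> S" "u \<in> lists S" "rev u \<in> lists S" by auto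
  then show ?case
    using Cons.IH by (simp add: word_prod_append generator_closed inv_mult_group generator_inv)
qed simp

text \<open>
  The parity of the number of indices \<open>i\<close> with \<open>t = s\<^sub>1 \<dots> s\<^sub>i \<dots> s\<^sub>1\<close>. Geometrically, the word
  is a gallery of chambers, and the question is whether it crosses the wall of \<open>t\<close> an odd
  number of times, that is, whether it ends on the other side of that wall.
\<close>

primrec crosses_oddly :: "'a list \<Rightarrow> 'a \<Rightarrow> bool" where
  "crosses_oddly [] t = False"
| "crosses_oddly (s # u) t = ((t = s) \<noteq> crosses_oddly u (s \<otimes> t \<otimes> s))"

text \<open>
  The second half of the gallery starts at the chamber of the product of \<open>u\<close>, hence the
  conjugation.
\<close>

lemma crosses_oddly_append:
  assumes "u \<in> lists S" "v \<in> lists S" "t \<in> carrier W"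
  shows "crosses_oddly (u @ v) t =
    (crosses_oddly u t \<noteq> crosses_oddly v (inv (word_prod W u) \<otimes> t \<otimes> word_prod W u))"
  using assms
proof (induction u arbitrary: t)
  case (Cons s u)
  then have s: "s \<in> S" "s \<in> carrier W" and u: "u \<in> lists S" "word_prod W u \<in> carrier W"
    by (auto simp: generator_closed)
  have "inv (word_prod W u) \<otimes> (s \<otimes> t \<otimes> s) \<otimes> word_prod W u =
      inv (word_prod W (s # u)) \<otimes> t \<otimes> word_prod W (s # u)"
    using s u Cons.prems by (simp add: inv_mult_group generator_inv m_assoc)
  then show ?case
    using Cons.IH[of "s \<otimes> t \<otimes> s"] Cons.prems s u by auto
qed simp

text \<open>
  In an alternating word, the reflection attached to position \<open>i\<close> (counted from 0) is
  \<open>(s t)\<^sup>i s\<close>.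
\<close>

lemma crosses_oddly_braid:
  assumes "s \<in> S" "t \<in> S" "x \<in> carrier W"
  shows "crosses_oddly (concat (replicate n [s, t])) x =
    odd (\<Sum>i<2 * n. of_bool (x = (s \<otimes> t) [^] i \<otimes> s) :: nat)"
  using assms(3)
proof (induction n arbitrary: x)
  case (Suc n)
  note [simp] = generator_closed[OF assms(1)] generator_closed[OF assms(2)] Suc.prems
  have pow2: "(s \<otimes> t) [^] Suc (Suc i) \<otimes> s = s \<otimes> t \<otimes> ((s \<otimes> t) [^] i \<otimes> s) \<otimes> t \<otimes> s" for i
  proof -
    have "(s \<otimes> t) [^] Suc (Suc i) \<otimes> s = (s \<otimes> t) [^] Suc i \<otimes> (s \<otimes> t) \<otimes> s"
      by simp
    also have "\<dots> = (s \<otimes> t) \<otimes> (s \<otimes> t) [^] i \<otimes> (s \<otimes> t) \<otimes> s"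
      by (simp only: nat_pow_Suc2 m_closed generator_closed assms)
    finally show ?thesis
      by (simp add: m_assoc)
  qed
  have conj: "(t \<otimes> (s \<otimes> x \<otimes> s) \<otimes> t = y) = (x = s \<otimes> t \<otimes> y \<otimes> t \<otimes> s)" if y: "y \<in> carrier W" for y
  proof -
    have "s \<otimes> t \<otimes> (t \<otimes> (s \<otimes> x \<otimes> s) \<otimes> t) \<otimes> t \<otimes> s = x"
      using assms by (simp add: m_assoc generator_cancel generator_square)
    moreover have "t \<otimes> (s \<otimes> (s \<otimes> t \<otimes> y \<otimes> t \<otimes> s) \<otimes> s) \<otimes> t = y"
      using assms y by (simp add: m_assoc generator_cancel generator_square)
    ultimately show ?thesis by metis
  qed
  have conj1: "(s \<otimes> x \<otimes> s = t) = (x = s \<otimes> t \<otimes> s)"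
  proof -
    have "s \<otimes> (s \<otimes> x \<otimes> s) \<otimes> s = x" "s \<otimes> (s \<otimes> t \<otimes> s) \<otimes> s = t"
      using assms by (simp_all add: m_assoc generator_cancel generator_square)
    then show ?thesis by metis
  qed
  have "(\<Sum>i<2 * Suc n. of_bool (x = (s \<otimes> t) [^] i \<otimes> s) :: nat) =
      of_bool (x = s) + (of_bool (x = s \<otimes> t \<otimes> s) +
      (\<Sum>i<2 * n. of_bool (x = (s \<otimes> t) [^] Suc (Suc i) \<otimes> s)))"
    by (simp add: sum.lessThan_Suc_shift del: sum.lessThan_Suc)
  also have "(\<Sum>i<2 * n. of_bool (x = (s \<otimes> t) [^] Suc (Suc i) \<otimes> s)) =
      (\<Sum>i<2 * n. of_bool (t \<otimes> (s \<otimes> x \<otimes> s) \<otimes> t = (s \<otimes> t) [^] i \<otimes> s) :: nat)"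
    by (simp only: conj pow2 m_closed nat_pow_closed generator_closed assms)
  finally show ?case
    using Suc.IH[of "t \<otimes> (s \<otimes> x \<otimes> s) \<otimes> t"] by (simp add: conj1)
qed simp

text \<open>
  Since \<open>(s t)\<^sup>m = 1\<close>, the reflections attached to the second half of the relator repeat those of
  the first half, so that each occurs an even number of times.
\<close>

lemma crosses_oddly_relator:
  assumes "s \<in> S" "t \<in> S" "x \<in> carrier W"
  shows "\<not> crosses_oddly (concat (replicate (ord (s \<otimes> t)) [s, t])) x"
proof -
  let ?m = "ord (s \<otimes> t)"
  let ?f = "\<lambda>i. of_bool (x = (s \<otimes> t) [^] i \<otimes> s) :: nat"
  have st: "s \<otimes> t \<in> carrier W"
    using assms generator_closed by blast
  have "sum ?f {..<2 * ?m} = sum ?f {..<?m} + sum ?f {?m..<?m + ?m}"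
    using sum.atLeastLessThan_concat[of 0 ?m "?m + ?m" ?f] by (simp add: mult_2 lessThan_atLeast0)
  also have "sum ?f {?m..<?m + ?m} = (\<Sum>i<?m. ?f (i + ?m))"
    using sum.shift_bounds_nat_ivl[of ?f 0 ?m ?m] by (simp add: lessThan_atLeast0)
  also have "\<dots> = sum ?f {..<?m}"
    using st by (intro sum.cong) (simp_all add: nat_pow_mult[symmetric] pow_ord_eq_1)
  finally show ?thesis
    using crosses_oddly_braid[OF assms] by simp
qed

text \<open>
  Reduces the invariance under a relation to the relator itself: as its product is trivial, it
  does not change the conjugation seen by the rest of the word.
\<close>

lemma crosses_oddly_delete:
  assumes "u \<in> lists S" "r \<in> lists S" "v \<in> lists S"
    and "word_prod W r = \<one>" "\<And>y. y \<in> carrier W \<Longrightarrow> \<not> crosses_oddly r y" "x \<in> carrier W"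
  shows "crosses_oddly (u @ r @ v) x = crosses_oddly (u @ v) x"
  using assms by (simp add: crosses_oddly_append word_prod_append)

lemma unsigned_word: "u \<in> lists (S \<times> UNIV) \<Longrightarrow> map fst u \<in> lists S"
  by (induction u) auto

text \<open>
  The equivalence of the two memberships is part of the induction because the words in the
  middle of a chain of transitivity steps range over arbitrary letters.
\<close>

lemma crosses_oddly_presentation_eq:
  assumes "presentation_eq S (coxeter_relators W S) u v"
  shows "(u \<in> lists (S \<times> UNIV) \<longleftrightarrow> v \<in> lists (S \<times> UNIV)) \<and>
    (u \<in> lists (S \<times> UNIV) \<longrightarrow>
      (\<forall>x \<in> carrier W. crosses_oddly (map fst u) x = crosses_oddly (map fst v) x))"
  using assms
proof (induction rule: presentation_eq.induct)
  case (cancel s u b v)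
  have "crosses_oddly (map fst u @ [s, s] @ map fst v) x = crosses_oddly (map fst u @ map fst v) x"
    if "u \<in> lists (S \<times> UNIV)" "v \<in> lists (S \<times> UNIV)" "x \<in> carrier W" for x
  proof (rule crosses_oddly_delete)
    fix y assume y: "y \<in> carrier W"
    have "(s \<otimes> y \<otimes> s = s) = (y = s)"
      using cancel y generator_closed[OF cancel] generator_cancel generator_cancel_right
      by (metis m_closed)
    then show "\<not> crosses_oddly [s, s] y" by simp
  qed (use that cancel in \<open>simp_all add: unsigned_word generator_square generator_closed\<close>)
  then show ?case using cancel by auto
next
  case (relator r u v)
  then obtain s t where st: "s \<in> S" "t \<in> S"
    and r: "r = concat (replicate (ord (s \<otimes> t)) [(s, True), (t, True)])"
    by (auto simp: coxeter_relators_def)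
  have fst_r: "map fst r = concat (replicate (ord (s \<otimes> t)) [s, t])"
    by (simp add: r map_concat)
  have r_word: "r \<in> lists (S \<times> UNIV)"
    using st by (auto simp: r in_lists_conv_set)
  have prod: "word_prod W (concat (replicate n [s, t])) = (s \<otimes> t) [^] n" for n
  proof (induction n)
    case (Suc n)
    then show ?case
      using st generator_closed by (simp only: nat_pow_Suc2 m_closed) (simp add: m_assoc)
  qed simp
  have "crosses_oddly (map fst u @ map fst r @ map fst v) x = crosses_oddly (map fst u @ map fst v) x"
    if "u \<in> lists (S \<times> UNIV)" "v \<in> lists (S \<times> UNIV)" "x \<in> carrier W" for x
    using that st r_word
    by (intro crosses_oddly_delete)
      (auto simp: fst_r prod pow_ord_eq_1 generator_closed crosses_oddly_relator in_lists_conv_set)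
  then show ?case using r_word by auto
qed auto

lemma crosses_oddly_trivial:
  assumes "u \<in> lists S" "word_prod W u = \<one>" "x \<in> carrier W"
  shows "\<not> crosses_oddly u x"
proof -
  let ?u = "map (\<lambda>s. (s, True)) u"
  have "signed_word_prod W ?u = \<one>"
    using assms(2) by (simp add: signed_word_prod_def word_prod_def foldr_map comp_def)
  then have "presentation_eq S (coxeter_relators W S) ?u []"
    using presentation[of ?u] assms(1) by (simp add: in_lists_conv_set)
  then have "crosses_oddly (map fst ?u) x = crosses_oddly [] x"
    using crosses_oddly_presentation_eq assms(1,3) by force
  then show ?thesis by (simp add: comp_def)
qed

text \<open>
  Both \<open>u v\<^sup>-\<^sup>1\<close> and \<open>v v\<^sup>-\<^sup>1\<close> are words for the identity, and the contributions of \<open>v\<^sup>-\<^sup>1\<close>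
  to them agree.
\<close>

lemma crosses_oddly_cong:
  assumes "u \<in> lists S" "v \<in> lists S" "word_prod W u = word_prod W v" "x \<in> carrier W"
  shows "crosses_oddly u x = crosses_oddly v x"
proof -
  have v: "rev v \<in> lists S" using assms(2) by auto
  have "\<not> crosses_oddly (u @ rev v) x" "\<not> crosses_oddly (v @ rev v) x"
    by (rule crosses_oddly_trivial; use assms v in \<open>simp add: word_prod_append word_prod_rev\<close>)+
  then show ?thesis
    using assms v by (simp add: crosses_oddly_append)
qed

text \<open>
  If \<open>t = s\<^sub>1 \<dots> s\<^sub>i \<dots> s\<^sub>1\<close>, then \<open>t s\<^sub>1 \<dots> s\<^sub>k\<close> cancels \<open>s\<^sub>i\<close>.
\<close>

lemma crosses_oddly_imp_deletion:
  assumes "u \<in> lists S" "t \<in> carrier W" "crosses_oddly u t"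
  shows "\<exists>i < length u. t \<otimes> word_prod W u = word_prod W (take i u @ drop (Suc i) u)"
  using assms
proof (induction u arbitrary: t)
  case (Cons s u)
  then have s: "s \<in> S" "s \<in> carrier W" and u: "u \<in> lists S" by (auto simp: generator_closed)
  show ?case
  proof (cases "t = s")
    case True
    then show ?thesis using s u by (intro exI[of _ 0]) (simp add: generator_cancel)
  next
    case False
    then have "crosses_oddly u (s \<otimes> t \<otimes> s)" using Cons.prems by simp
    then obtain i where i: "i < length u"
      "s \<otimes> t \<otimes> s \<otimes> word_prod W u = word_prod W (take i u @ drop (Suc i) u)"
      using Cons.IH[of "s \<otimes> t \<otimes> s"] Cons.prems s u by auto
    have "s \<otimes> (s \<otimes> t \<otimes> s \<otimes> word_prod W u) = t \<otimes> (s \<otimes> word_prod W u)"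
      using s u Cons.prems by (simp add: m_assoc generator_cancel)
    with i show ?thesis by (intro exI[of _ "Suc i"]) simp
  qed
qed simp

lemma word_exists:
  assumes "w \<in> carrier W" shows "\<exists>u \<in> lists S. word_prod W u = w"
proof -
  have "w \<in> generate W S" using assms generators_generate by simp
  then show ?thesis
  proof (induction rule: generate.induct)
    case one then show ?case by (intro bexI[of _ "[]"]) auto
  next
    case (incl h) then show ?case by (intro bexI[of _ "[h]"]) (auto simp: generator_closed)
  next
    case (inv h) then show ?case
      by (intro bexI[of _ "[h]"]) (auto simp: generator_closed generator_inv)
  next
    case (eng h1 h2) then show ?case by (metis word_prod_append append_in_lists_conv)
  qed
qed

abbreviation len :: "'a \<Rightarrow> nat" where
  "len \<equiv> coxeter_length W S"

abbreviation reduced :: "'a list \<Rightarrow> 'a \<Rightarrow> bool" where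
  "reduced \<equiv> reduced_expression W S"

lemma reduced_exists:
  assumes "w \<in> carrier W" shows "\<exists>u. reduced u w"
proof -
  have "\<exists>n. \<exists>u \<in> lists S. word_prod W u = w \<and> length u = n"
    using word_exists[OF assms] by blast
  then have "\<exists>u \<in> lists S. word_prod W u = w \<and> length u = len w"
    unfolding coxeter_length_def by (rule LeastI_ex)
  then show ?thesis by (auto simp: reduced_expression_def)
qed

lemma length_le: "u \<in> lists S \<Longrightarrow> len (word_prod W u) \<le> length u"
  unfolding coxeter_length_def by (rule Least_le) blast

lemma length_one [simp]: "len \<one> = 0"
  using length_le[of "[]"] by simp

lemma length_mult_le: "s \<in> S \<Longrightarrow> w \<in> carrier W \<Longrightarrow> len (s \<otimes> w) \<le> Suc (len w)"
  using reduced_exists[of w] length_le[of "s # u" for u]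
  by (fastforce simp: reduced_expression_def)

lemma length_inv:
  assumes "w \<in> carrier W" shows "len (inv w) = len w"
proof -
  have "len (inv w) \<le> len w" if "w \<in> carrier W" for w
    using reduced_exists[OF that] length_le[of "rev u" for u]
    by (fastforce simp: reduced_expression_def word_prod_rev)
  from this[of w] this[of "inv w"] show ?thesis using assms by simp
qed

lemma length_inv_mult:
  "s \<in> S \<Longrightarrow> w \<in> carrier W \<Longrightarrow> len (inv w \<otimes> s) = len (s \<otimes> w)"
  "s \<in> S \<Longrightarrow> w \<in> carrier W \<Longrightarrow> len (s \<otimes> inv w) = len (w \<otimes> s)"
  using length_inv[of "s \<otimes> w"] length_inv[of "w \<otimes> s"]
  by (simp_all add: inv_mult_group generator_inv generator_closed)

lemma length_mult_right_le: "s \<in> S \<Longrightarrow> w \<in> carrier W \<Longrightarrow> len (w \<otimes> s) \<le> Suc (len w)"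
  using length_mult_le[of s "inv w"] by (simp add: length_inv_mult length_inv)

text \<open>
  If \<open>u\<close> crosses the wall of \<open>s\<close> oddly, then a letter of a shortest word for the same element can
  be deleted. Otherwise \<open>s u\<close> crosses it oddly, as its first letter is one more crossing, and the
  same argument applies to \<open>s u\<close>. In particular multiplication by \<open>s\<close> always changes the length.
\<close>

lemma descent_iff_crosses_oddly:
  assumes "s \<in> S" "u \<in> lists S"
  shows "len (s \<otimes> word_prod W u) < len (word_prod W u) \<longleftrightarrow> crosses_oddly u s"
    and "len (s \<otimes> word_prod W u) \<noteq> len (word_prod W u)"
proof -
  have shorter: "len (s \<otimes> word_prod W u) < len (word_prod W u)"
    if u: "u \<in> lists S" and c: "crosses_oddly u s" for u
  proof -
    obtain v where v: "reduced v (word_prod W u)"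
      using reduced_exists[OF word_prod_closed[OF u]] by blast
    then have "crosses_oddly v s"
      using crosses_oddly_cong[of u v] u c assms generator_closed
      by (auto simp: reduced_expression_def)
    then obtain i where "i < length v"
      "s \<otimes> word_prod W v = word_prod W (take i v @ drop (Suc i) v)"
      using crosses_oddly_imp_deletion[of v s] v assms generator_closed
      by (auto simp: reduced_expression_def)
    moreover have "take i v @ drop (Suc i) v \<in> lists S"
      using v by (auto simp: reduced_expression_def in_lists_conv_set dest: in_set_takeD in_set_dropD)
    ultimately show ?thesis
      using v length_le[of "take i v @ drop (Suc i) v"] by (auto simp: reduced_expression_def)
  qed
  have longer: "len (word_prod W u) < len (s \<otimes> word_prod W u)" if "\<not> crosses_oddly u s"
  proof -
    have "crosses_oddly (s # u) s"
      using that assms by (simp add: generator_square generator_closed)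
    from shorter[OF _ this] show ?thesis
      using assms by (simp add: generator_cancel)
  qed
  show "len (s \<otimes> word_prod W u) < len (word_prod W u) \<longleftrightarrow> crosses_oddly u s"
    and "len (s \<otimes> word_prod W u) \<noteq> len (word_prod W u)"
    using shorter[OF assms(2)] longer by fastforce+
qed

lemma length_mult_neq:
  assumes "s \<in> S" "w \<in> carrier W" shows "len (s \<otimes> w) \<noteq> len w"
  using descent_iff_crosses_oddly(2)[of s] word_exists assms by metis

lemma length_descent:
  assumes "s \<in> S" "w \<in> carrier W" "len (s \<otimes> w) < len w" shows "len w = Suc (len (s \<otimes> w))"
  using length_mult_le[of s "s \<otimes> w"] assms by (simp add: generator_cancel generator_closed)

theorem exchange:
  assumes "s \<in> S" "u \<in> lists S" "len (s \<otimes> word_prod W u) < len (word_prod W u)"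
  shows "\<exists>i < length u. s \<otimes> word_prod W u = word_prod W (take i u @ drop (Suc i) u)"
  using crosses_oddly_imp_deletion[of u s] descent_iff_crosses_oddly(1)[of s u] assms generator_closed
  by blast

text \<open>
  Write \<open>w q\<close> as a reduced word of \<open>w\<close> followed by \<open>q\<close>. The exchange condition for \<open>s\<close> deletes a
  letter of it, and this letter must be the last one: deleting a letter of \<open>w\<close> instead would make
  \<open>s\<close> a left descent of \<open>w\<close>.
\<close>

lemma lifting:
  assumes "s \<in> S" "q \<in> S" "w \<in> carrier W"
    and "len w < len (s \<otimes> w)" "len (s \<otimes> (w \<otimes> q)) < len (w \<otimes> q)"
  shows "s \<otimes> (w \<otimes> q) = w"
proof -
  obtain u where u: "u \<in> lists S" "word_prod W u = w" "length u = len w"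
    using reduced_exists[OF assms(3)] by (auto simp: reduced_expression_def)
  have uq: "u @ [q] \<in> lists S" "word_prod W (u @ [q]) = w \<otimes> q"
    using u assms by (auto simp: word_prod_append generator_closed)
  obtain i where i: "i < length (u @ [q])"
    "s \<otimes> (w \<otimes> q) = word_prod W (take i (u @ [q]) @ drop (Suc i) (u @ [q]))"
    using exchange[of s "u @ [q]"] uq assms by auto
  show ?thesis
  proof (cases "i = length u")
    case True
    then show ?thesis using i u by simp
  next
    case False
    define v where "v = take i u @ drop (Suc i) u"
    have v: "v \<in> lists S" "length v < len w"
      using i u False by (auto simp: v_def in_lists_conv_set dest: in_set_takeD in_set_dropD)
    have "s \<otimes> (w \<otimes> q) = word_prod W (v @ [q])"
      using i False by (simp add: v_def)
    also have "\<dots> = word_prod W v \<otimes> q"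
      using v(1) assms(2) by (simp add: word_prod_append generator_closed)
    finally have "s \<otimes> w \<otimes> q = word_prod W v \<otimes> q"
      using assms by (simp add: m_assoc generator_closed)
    then have "s \<otimes> w = word_prod W v"
      using assms v(1) by (simp add: generator_closed)
    then show ?thesis
      using length_le[OF v(1)] v(2) assms(4) by simp
  qed
qed

end

section \<open>Subwords and facets\<close>

lemma subword_cong:
  assumes "\<And>i. i \<in> positions Q \<Longrightarrow> i \<in> A \<longleftrightarrow> i \<in> B"
  shows "subword Q A = subword Q B"
proof -
  have "filter (\<lambda>p. snd p \<in> {i. Suc i \<in> A}) (zip Q [0..<length Q]) =
      filter (\<lambda>p. snd p \<in> {i. Suc i \<in> B}) (zip Q [0..<length Q])"
    using assms by (intro filter_cong) (auto simp: positions_def dest: set_zip_rightD)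
  then show ?thesis by (simp add: subword_def nths_def)
qed

lemma subword_Nil [simp]: "subword [] A = []"
  by (simp add: subword_def)

lemma subword_Cons:
  "subword (q # Q) A = (if 1 \<in> A then [q] else []) @ subword Q {i. Suc i \<in> A}"
  by (simp add: subword_def nths_Cons)

lemma subword_snoc:
  "subword (Q @ [q]) A = subword Q A @ (if Suc (length Q) \<in> A then [q] else [])"
  by (simp add: subword_def nths_append)

lemma positions_Nil [simp]: "positions [] = {}"
  by (simp add: positions_def)

lemma positions_Cons: "positions (q # Q) = insert 1 (Suc ` positions Q)"
  by (auto simp: positions_def image_Suc_atLeastAtMost)

lemma positions_snoc: "positions (Q @ [q]) = insert (Suc (length Q)) (positions Q)"
  by (auto simp: positions_def)

lemma positions_bounds: "0 \<notin> positions Q" "Suc (length Q) \<notin> positions Q"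
  by (auto simp: positions_def)

lemma subword_positions: "subword Q (positions Q) = Q"
  unfolding subword_def by (rule nths_all) (simp add: positions_def)

lemma length_subword: "length (subword Q (positions Q - F)) = card (positions Q - F)"
proof -
  have "positions Q - F = Suc ` {i. i < length Q \<and> Suc i \<in> positions Q - F}"
    by (auto simp: positions_def image_iff) (metis Suc_le_lessD Suc_pred)
  then have "card (positions Q - F) = card {i. i < length Q \<and> Suc i \<in> positions Q - F}"
    by (metis card_image inj_Suc)
  then show ?thesis by (simp add: subword_def length_nths)
qed

lemma subseq_subword:
  assumes "subseq u (subword Q (positions Q - F))" "F \<subseteq> positions Q"
  obtains G where "F \<subseteq> G" "G \<subseteq> positions Q" "u = subword Q (positions Q - G)"
proof -
  let ?A = "{i. Suc i \<in> positions Q - F}"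
  obtain N where N: "u = nths (nths Q ?A) N"
    using assms(1) by (auto simp: subseq_conv_nths subword_def)
  define C where "C = {i \<in> ?A. \<exists>j \<in> N. card {i' \<in> ?A. i' < i} = j}"
  have C: "C \<subseteq> ?A" "u = nths Q C"
    unfolding C_def by (blast, simp only: N nths_nths)
  let ?G = "positions Q - Suc ` C"
  have "{i. Suc i \<in> positions Q - ?G} = C"
    using C(1) by (auto simp: positions_def)
  then have "u = subword Q (positions Q - ?G)"
    using C(2) by (simp add: subword_def)
  moreover have "F \<subseteq> ?G" using C(1) assms(2) by auto
  ultimately show thesis using that by blast
qed

text \<open>
  Carries a deletion from a subword over to the set of positions in the ambient word.
\<close>

lemma subword_delete:
  assumes "i < length (subword Q A)"
  shows "\<exists>j \<in> A \<inter> positions Q.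
    subword Q (A - {j}) = take i (subword Q A) @ drop (Suc i) (subword Q A)"
  using assms
proof (induction Q arbitrary: A i)
  case (Cons q Q)
  let ?A = "{i. Suc i \<in> A}"
  have later: ?case
    if "k < length (subword Q ?A)" "i = (if 1 \<in> A then Suc k else k)" for k
  proof -
    obtain j where j: "j \<in> ?A \<inter> positions Q"
      "subword Q (?A - {j}) = take k (subword Q ?A) @ drop (Suc k) (subword Q ?A)"
      using Cons.IH \<open>k < length (subword Q ?A)\<close> by blast
    have "{i. Suc i \<in> A - {Suc j}} = ?A - {j}" "Suc j \<noteq> 1"
      using j(1) by (auto simp: positions_def)
    with j that(2) show ?thesis
      by (intro bexI[of _ "Suc j"]) (auto simp: subword_Cons positions_Cons)
  qed
  show ?case
  proof (cases "1 \<in> A")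
    case True
    show ?thesis
    proof (cases i)
      case 0
      have "subword Q {i. Suc i \<in> A - {1}} = subword Q ?A"
        by (rule subword_cong) (auto simp: positions_def)
      then show ?thesis
        using 0 True by (intro bexI[of _ 1]) (auto simp: subword_Cons positions_Cons)
    next
      case (Suc k)
      then show ?thesis using later[of k] True Cons.prems by (simp add: subword_Cons)
    qed
  next
    case False
    then show ?thesis using later[of i] Cons.prems by (simp add: subword_Cons)
  qed
qed simp

context coxeter_system
begin

lemma reduced_Cons:
  assumes "w \<in> carrier W"
  shows "reduced (q # u) w \<longleftrightarrow> q \<in> S \<and> reduced u (q \<otimes> w) \<and> len (q \<otimes> w) < len w"
proof
  assume *: "reduced (q # u) w"
  then have q: "q \<in> S" and u: "u \<in> lists S" by (auto simp: reduced_expression_def)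
  have "w = q \<otimes> word_prod W u" using * by (simp add: reduced_expression_def)
  then have qw: "q \<otimes> w = word_prod W u"
    using q word_prod_closed[OF u] by (simp only: generator_cancel)
  have "len w \<le> Suc (len (q \<otimes> w))"
    using length_mult_le[of q "q \<otimes> w"] q assms by (simp add: generator_cancel generator_closed)
  then show "q \<in> S \<and> reduced u (q \<otimes> w) \<and> len (q \<otimes> w) < len w"
    using * q u qw length_le[OF u] by (auto simp: reduced_expression_def)
next
  assume *: "q \<in> S \<and> reduced u (q \<otimes> w) \<and> len (q \<otimes> w) < len w"
  then show "reduced (q # u) w"
    using length_descent[of q w] assms by (auto simp: reduced_expression_def generator_cancel)
qed

lemma reduced_rev:
  assumes "w \<in> carrier W" shows "reduced (rev u) (inv w) \<longleftrightarrow> reduced u w"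
proof -
  have "reduced (rev u) (inv w)" if "reduced u w" "w \<in> carrier W" for u w
    using that word_prod_rev by (auto simp: reduced_expression_def length_inv)
  from this[of u w] this[of "rev u" "inv w"] show ?thesis using assms by auto
qed

lemma reduced_snoc:
  assumes "w \<in> carrier W"
  shows "reduced (u @ [q]) w \<longleftrightarrow> q \<in> S \<and> reduced u (w \<otimes> q) \<and> len (w \<otimes> q) < len w"
proof -
  have "reduced (u @ [q]) w \<longleftrightarrow> reduced (q # rev u) (inv w)"
    using reduced_rev[of w "u @ [q]"] assms by simp
  also have "\<dots> \<longleftrightarrow> q \<in> S \<and> reduced (rev u) (q \<otimes> inv w) \<and> len (q \<otimes> inv w) < len (inv w)"
    using assms by (simp add: reduced_Cons)
  also have "\<dots> \<longleftrightarrow> q \<in> S \<and> reduced u (w \<otimes> q) \<and> len (w \<otimes> q) < len w"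
    using assms reduced_rev[of "w \<otimes> q" u]
    by (auto simp: length_inv_mult length_inv inv_mult_group generator_inv generator_closed)
  finally show ?thesis .
qed

abbreviation facet_set :: "'a list \<Rightarrow> 'a \<Rightarrow> nat set set" where
  "facet_set \<equiv> facets W S"

text \<open>
  All reduced expressions of \<open>w\<close> have the same length, so no two of these sets are strictly
  contained in one another, and every face extends to one of them.
\<close>

lemma facet_iff:
  "F \<in> facet_set Q w \<longleftrightarrow> F \<subseteq> positions Q \<and> reduced (subword Q (positions Q - F)) w"
proof -
  have face: "G \<in> subword_complex W S Q w"
    if "G \<subseteq> positions Q" "reduced (subword Q (positions Q - G)) w" for G
    using that by (auto simp: subword_complex_def contains_reduced_def)
  have extend: "\<exists>G. F \<subseteq> G \<and> G \<subseteq> positions Q \<and> reduced (subword Q (positions Q - G)) w"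
    if F: "F \<in> subword_complex W S Q w" for F
  proof -
    from F obtain u where u: "F \<subseteq> positions Q" "subseq u (subword Q (positions Q - F))" "reduced u w"
      by (auto simp: subword_complex_def contains_reduced_def)
    from subseq_subword[OF u(2,1)] u(3) show ?thesis by metis
  qed
  have maximal: "F = G" if "F \<subseteq> G" "G \<subseteq> positions Q"
    "reduced (subword Q (positions Q - F)) w" "reduced (subword Q (positions Q - G)) w" for F G
  proof -
    have "card (positions Q - F) = card (positions Q - G)"
      using that by (simp add: reduced_expression_def flip: length_subword)
    moreover have "positions Q - G \<subseteq> positions Q - F" "finite (positions Q - F)"
      using that by (auto simp: positions_def)
    ultimately have "positions Q - G = positions Q - F"
      by (simp add: card_subset_eq)
    with that show ?thesis by blast
  qed
  show ?thesis
  proof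
    assume F: "F \<in> facet_set Q w"
    then have "F \<in> subword_complex W S Q w" by (simp add: facets_def)
    from extend[OF this] obtain G where G: "F \<subseteq> G" "G \<subseteq> positions Q"
      "reduced (subword Q (positions Q - G)) w" by blast
    then have "F = G" using F face by (auto simp: facets_def)
    with G show "F \<subseteq> positions Q \<and> reduced (subword Q (positions Q - F)) w" by simp
  next
    assume F: "F \<subseteq> positions Q \<and> reduced (subword Q (positions Q - F)) w"
    have "F = G" if G: "G \<in> subword_complex W S Q w" "F \<subseteq> G" for G
    proof -
      obtain H where "G \<subseteq> H" "H \<subseteq> positions Q" "reduced (subword Q (positions Q - H)) w"
        using extend[OF G(1)] by blast
      with maximal[of F H] F G(2) show ?thesis by blast
    qed
    with face F show "F \<in> facet_set Q w" by (auto simp: facets_def)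
  qed
qed

lemma facet_subset: "F \<in> facet_set Q w \<Longrightarrow> F \<subseteq> positions Q"
  by (simp add: facet_iff)

lemma facets_nonempty:
  assumes "contains_reduced W S Q w" shows "facet_set Q w \<noteq> {}"
proof -
  obtain u where "subseq u (subword Q (positions Q - {}))" "reduced u w"
    using assms by (auto simp: contains_reduced_def subword_positions)
  then show ?thesis
    using subseq_subword[of u Q "{}"] facet_iff by (metis empty_iff empty_subsetI)
qed

lemma facets_Nil: "w \<in> carrier W \<Longrightarrow> facet_set [] w = (if w = \<one> then {{}} else {})"
  by (auto simp: facet_iff reduced_expression_def)

text \<open>
  A facet without position 1 uses the first letter, which is therefore the first letter of a
  reduced expression of \<open>w\<close>.
\<close>

lemma facets_Cons:
  assumes "q \<in> S" "w \<in> carrier W"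
  shows "facet_set (q # Q) w =
    (if len (q \<otimes> w) < len w then image Suc ` facet_set Q (q \<otimes> w) else {}) \<union>
    (\<lambda>I. insert 1 (Suc ` I)) ` facet_set Q w"
proof -
  \<comment> \<open>The sets on the left-hand sides also contain 0, which is not a position.\<close>
  have sub: "subword Q {i. Suc i \<in> positions (q # Q) - Suc ` I} = subword Q (positions Q - I)"
    "subword Q {i. Suc i \<in> positions (q # Q) - insert 1 (Suc ` I)} = subword Q (positions Q - I)" for I
    by (rule subword_cong; force simp: positions_def)+
  have without: "Suc ` I \<in> facet_set (q # Q) w \<longleftrightarrow> len (q \<otimes> w) < len w \<and> I \<in> facet_set Q (q \<otimes> w)"
    if "I \<subseteq> positions Q" for I
  proof -
    have "1 \<in> positions (q # Q) - Suc ` I" using that positions_bounds by (auto simp: positions_Cons)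
    then have "subword (q # Q) (positions (q # Q) - Suc ` I) = q # subword Q (positions Q - I)"
      by (simp only: subword_Cons sub) simp
    then show ?thesis
      using that assms by (auto simp: facet_iff reduced_Cons positions_Cons)
  qed
  have "with": "insert 1 (Suc ` I) \<in> facet_set (q # Q) w \<longleftrightarrow> I \<in> facet_set Q w"
    if "I \<subseteq> positions Q" for I
  proof -
    have "subword (q # Q) (positions (q # Q) - insert 1 (Suc ` I)) = subword Q (positions Q - I)"
      by (simp only: subword_Cons sub) simp
    then show ?thesis
      using that by (auto simp: facet_iff positions_Cons)
  qed
  have split: "\<exists>I \<subseteq> positions Q. F = Suc ` I \<or> F = insert 1 (Suc ` I)" if "F \<subseteq> positions (q # Q)" for F
  proof (intro exI[of _ "{i \<in> positions Q. Suc i \<in> F}"] conjI)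
    show "F = Suc ` {i \<in> positions Q. Suc i \<in> F} \<or> F = insert 1 (Suc ` {i \<in> positions Q. Suc i \<in> F})"
      using that by (auto simp: positions_Cons)
  qed auto
  show ?thesis
  proof (intro Set.set_eqI iffI)
    fix F assume F: "F \<in> facet_set (q # Q) w"
    obtain I where I: "I \<subseteq> positions Q" "F = Suc ` I \<or> F = insert 1 (Suc ` I)"
      using split[OF facet_subset[OF F]] by blast
    show "F \<in> (if len (q \<otimes> w) < len w
      then image Suc ` facet_set Q (q \<otimes> w) else {}) \<union> (\<lambda>I. insert 1 (Suc ` I)) ` facet_set Q w"
      using I(2) F without[OF I(1)] "with"[OF I(1)] by auto
  next
    fix F assume "F \<in> (if len (q \<otimes> w) < len w
      then image Suc ` facet_set Q (q \<otimes> w) else {}) \<union> (\<lambda>I. insert 1 (Suc ` I)) ` facet_set Q w"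
    then show "F \<in> facet_set (q # Q) w"
      using without "with" facet_subset by (auto split: if_splits)
  qed
qed

lemma facets_snoc:
  assumes "q \<in> S" "w \<in> carrier W"
  shows "facet_set (Q @ [q]) w =
    (if len (w \<otimes> q) < len w then facet_set Q (w \<otimes> q) else {}) \<union>
    insert (Suc (length Q)) ` facet_set Q w"
proof -
  let ?m = "Suc (length Q)"
  have sub: "subword Q (positions (Q @ [q]) - I) = subword Q (positions Q - I)" for I
    by (rule subword_cong) (auto simp: positions_def)
  have pos: "positions (Q @ [q]) - insert ?m I = positions Q - I" for I
    by (auto simp: positions_def)
  have without: "I \<in> facet_set (Q @ [q]) w \<longleftrightarrow> len (w \<otimes> q) < len w \<and> I \<in> facet_set Q (w \<otimes> q)"
    if "I \<subseteq> positions Q" for I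
  proof -
    have "?m \<in> positions (Q @ [q]) - I" using that positions_bounds by (auto simp: positions_snoc)
    then have "subword (Q @ [q]) (positions (Q @ [q]) - I) = subword Q (positions Q - I) @ [q]"
      by (simp only: subword_snoc sub) simp
    then show ?thesis
      using that assms by (auto simp: facet_iff reduced_snoc positions_snoc)
  qed
  have "with": "insert ?m I \<in> facet_set (Q @ [q]) w \<longleftrightarrow> I \<in> facet_set Q w"
    if "I \<subseteq> positions Q" for I
  proof -
    have "subword (Q @ [q]) (positions (Q @ [q]) - insert ?m I) = subword Q (positions Q - I)"
      using positions_bounds(2)[of Q] by (simp add: pos subword_snoc)
    then show ?thesis
      using that by (auto simp: facet_iff positions_snoc)
  qed
  have split: "\<exists>I \<subseteq> positions Q. F = I \<or> F = insert ?m I" if "F \<subseteq> positions (Q @ [q])" for F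
    using that by (intro exI[of _ "F \<inter> positions Q"]) (auto simp: positions_snoc)
  show ?thesis
  proof (intro Set.set_eqI iffI)
    fix F assume F: "F \<in> facet_set (Q @ [q]) w"
    obtain I where I: "I \<subseteq> positions Q" "F = I \<or> F = insert ?m I"
      using split[OF facet_subset[OF F]] by blast
    show "F \<in> (if len (w \<otimes> q) < len w
      then facet_set Q (w \<otimes> q) else {}) \<union> insert ?m ` facet_set Q w"
      using I(2) F without[OF I(1)] "with"[OF I(1)] by auto
  next
    fix F assume "F \<in> (if len (w \<otimes> q) < len w
      then facet_set Q (w \<otimes> q) else {}) \<union> insert ?m ` facet_set Q w"
    then show "F \<in> facet_set (Q @ [q]) w"
      using without "with" facet_subset by (auto split: if_splits)
  qed
qed

end

section \<open>The unique sink of the increasing flip graph\<close>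

lemma increasing_flipI:
  assumes "i \<notin> K" "j \<notin> K" "i < j" shows "increasing_flip (insert i K) (insert j K)"
proof -
  have "insert i K - {i} = insert j K - {j}" "i \<notin> insert j K" using assms by auto
  then show ?thesis using assms(3) unfolding increasing_flip_def by blast
qed

lemma increasing_flipE:
  assumes "increasing_flip I J"
  obtains K i j where "i \<notin> K" "j \<notin> K" "i < j" "I = insert i K" "J = insert j K"
proof -
  obtain i j where ij: "i \<in> I" "j \<in> J" "I - {i} = J - {j}" "i < j"
    using assms by (auto simp: increasing_flip_def)
  show thesis
  proof (rule that)
    show "I = insert i (I - {i})" using ij(1) by blast
    show "J = insert j (I - {i})" unfolding ij(3) using ij(2) by blast
    show "j \<notin> I - {i}" unfolding ij(3) by blast
  qed (use ij in auto)
qed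

lemma increasing_flip_insert:
  assumes "z \<notin> I" "z \<notin> J"
  shows "increasing_flip (insert z I) (insert z J) \<longleftrightarrow> increasing_flip I J"
proof
  assume "increasing_flip I J"
  then obtain K i j where K: "i \<notin> K" "j \<notin> K" "i < j" "I = insert i K" "J = insert j K"
    by (rule increasing_flipE)
  have "increasing_flip (insert i (insert z K)) (insert j (insert z K))"
    by (rule increasing_flipI) (use K assms in auto)
  then show "increasing_flip (insert z I) (insert z J)"
    using K by (simp add: insert_commute)
next
  assume "increasing_flip (insert z I) (insert z J)"
  then obtain K i j where K: "i \<notin> K" "j \<notin> K" "i < j" "insert z I = insert i K" "insert z J = insert j K"
    by (rule increasing_flipE)
  have z: "z \<noteq> i" "z \<noteq> j" using K by (metis insertE insertI1 nat_neq_iff)+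
  have "I = insert i K - {z}" "J = insert j K - {z}"
    using assms by (simp_all flip: K(4,5))
  then have "I = insert i (K - {z})" "J = insert j (K - {z})"
    using z by (simp_all add: insert_Diff_if)
  moreover have "increasing_flip (insert i (K - {z})) (insert j (K - {z}))"
    by (rule increasing_flipI) (use K in auto)
  ultimately show "increasing_flip I J" by simp
qed

lemma increasing_flip_image_Suc: "increasing_flip (Suc ` I) (Suc ` J) \<longleftrightarrow> increasing_flip I J"
proof -
  have *: "Suc ` I - {Suc i} = Suc ` (I - {i})" for I i by auto
  show ?thesis
    by (auto simp: increasing_flip_def * inj_image_eq_iff)
qed

definition flip_sink :: "nat set set \<Rightarrow> nat set \<Rightarrow> bool" where
  "flip_sink V I \<longleftrightarrow> I \<in> V \<and> (\<forall>J \<in> V. \<not> increasing_flip I J)"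

context coxeter_system
begin

text \<open>
  The exchange condition for facets: once \<open>s\<close> has been used in front of \<open>Q\<close>, some letter of a
  reduced expression of \<open>w\<close> in \<open>Q\<close> becomes superfluous. Its position \<open>j\<close> is the one that
  enters when position 1 of \<open>s # Q\<close> is flipped out of the facet.
\<close>

lemma exchange_flip:
  assumes "s \<in> S" "I \<in> facet_set Q w" "len (s \<otimes> w) < len w"
  obtains j where "j \<in> positions Q" "j \<notin> I" "insert j I \<in> facet_set Q (s \<otimes> w)"
proof -
  define u where "u = subword Q (positions Q - I)"
  have u: "u \<in> lists S" "word_prod W u = w" "length u = len w" and I: "I \<subseteq> positions Q"
    using assms(2) by (auto simp: u_def facet_iff reduced_expression_def)
  obtain i where i: "i < length u" "s \<otimes> w = word_prod W (take i u @ drop (Suc i) u)"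
    using exchange[OF assms(1) u(1)] assms(3) u(2) by auto
  obtain j where j: "j \<in> positions Q" "j \<notin> I"
    "subword Q (positions Q - I - {j}) = take i u @ drop (Suc i) u"
    using subword_delete[of i Q "positions Q - I"] i(1) unfolding u_def by auto
  have w: "w \<in> carrier W" using u(1,2) word_prod_closed by metis
  have "set (take i u @ drop (Suc i) u) \<subseteq> S"
    using u(1) by (auto dest: in_set_takeD in_set_dropD)
  then have "take i u @ drop (Suc i) u \<in> lists S" by (auto simp: in_lists_conv_set)
  moreover have "length (take i u @ drop (Suc i) u) = len (s \<otimes> w)"
    using i(1) u(3) length_descent[OF assms(1) w assms(3)] by simp
  ultimately have "reduced (take i u @ drop (Suc i) u) (s \<otimes> w)"
    using i(2) by (simp add: reduced_expression_def)
  moreover have "positions Q - insert j I = positions Q - I - {j}" by blast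
  ultimately have "insert j I \<in> facet_set Q (s \<otimes> w)"
    using j I by (simp add: facet_iff)
  with j that show thesis by blast
qed

text \<open>
  The positions skipped when the letters of \<open>Q\<close> are used for \<open>w\<close> as early as possible.
\<close>

fun left_greedy :: "'a list \<Rightarrow> 'a \<Rightarrow> nat set" where
  "left_greedy [] w = {}"
| "left_greedy (s # Q) w =
     (if len (s \<otimes> w) < len w then Suc ` left_greedy Q (s \<otimes> w)
      else insert 1 (Suc ` left_greedy Q w))"

lemma facets_descent_nonempty:
  assumes "s \<in> S" "w \<in> carrier W" "len (s \<otimes> w) < len w" "facet_set (s # Q) w \<noteq> {}"
  shows "facet_set Q (s \<otimes> w) \<noteq> {}"
proof -
  obtain F where "F \<in> facet_set (s # Q) w" using assms(4) by blast
  then consider "facet_set Q (s \<otimes> w) \<noteq> {}" | I where "I \<in> facet_set Q w"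
    using facets_Cons[OF assms(1,2)] by (auto split: if_splits)
  then show ?thesis
    using exchange_flip[OF assms(1) _ assms(3)] by (metis empty_iff)
qed

text \<open>
  If the first letter is a descent, a facet containing position 1 has an increasing flip by
  \<open>exchange_flip\<close>, whereas a facet without position 1 has no increasing flip to one with it; if
  the first letter is not a descent, all facets contain position 1. In both cases the sinks
  are those of the remaining word, which is how \<open>left_greedy\<close> recurses.
\<close>

theorem flip_sink_iff_left_greedy:
  assumes "Q \<in> lists S" "w \<in> carrier W" "facet_set Q w \<noteq> {}"
  shows "flip_sink (facet_set Q w) I \<longleftrightarrow> I = left_greedy Q w"
  using assms
proof (induction Q arbitrary: w I rule: list.induct)
  case Nil
  then show ?case by (auto simp: facets_Nil flip_sink_def increasing_flip_def split: if_splits)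
next
  case (Cons s Q)
  then have s: "s \<in> S" "s \<in> carrier W" and Q: "Q \<in> lists S" by (auto simp: generator_closed)
  note w = Cons.prems(2)
  have nz: "0 \<notin> J" if "J \<in> facet_set Q v" for J v
    using facet_subset[OF that] positions_bounds by blast
  show ?case
  proof (cases "len (s \<otimes> w) < len w")
    case True
    let ?without = "facet_set Q (s \<otimes> w)" and ?containing = "facet_set Q w"
    let ?V = "facet_set (s # Q) w"
    have V: "?V = image Suc ` ?without \<union> (\<lambda>I. insert 1 (Suc ` I)) ` ?containing"
      using True facets_Cons[OF s(1) w, of Q] by simp
    have ne: "?without \<noteq> {}" using facets_descent_nonempty s(1) w True Cons.prems(3) by blast
    have no: "\<not> increasing_flip (Suc ` J) (insert 1 (Suc ` K))" if "J \<in> ?without" for J K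
    proof
      assume "increasing_flip (Suc ` J) (insert 1 (Suc ` K))"
      then obtain M i j where M: "i < j" "Suc ` J = insert i M" "insert 1 (Suc ` K) = insert j M"
        by (rule increasing_flipE)
      have "1 \<notin> Suc ` J" using nz[OF that] by auto
      with M have "j = 1" "i \<noteq> 0" by (metis insertE insertI1 insertI2, metis Zero_not_Suc imageE insertI1)
      with M show False by simp
    qed
    have yes: "\<not> flip_sink ?V (insert 1 (Suc ` K))" if K: "K \<in> ?containing" for K
    proof -
      obtain j where j: "j \<in> positions Q" "j \<notin> K" "insert j K \<in> ?without"
        using exchange_flip[OF s(1) K True] by blast
      have "increasing_flip (insert 1 (Suc ` K)) (insert (Suc j) (Suc ` K))"
        using j nz[OF K] by (intro increasing_flipI) (auto simp: positions_def)
      moreover have "insert (Suc j) (Suc ` K) \<in> ?V" using j(3) V by (metis UnI1 image_insert imageI)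
      ultimately show ?thesis by (auto simp: flip_sink_def)
    qed
    have sink: "flip_sink ?V (Suc ` J) \<longleftrightarrow> flip_sink ?without J" if "J \<in> ?without" for J
      using that no unfolding flip_sink_def V ball_Un
      by (auto simp: increasing_flip_image_Suc)
    have "flip_sink ?V I \<longleftrightarrow> (\<exists>J. I = Suc ` J \<and> flip_sink ?without J)"
    proof
      assume I: "flip_sink ?V I"
      then have "I \<in> ?V" by (simp add: flip_sink_def)
      then obtain J where "J \<in> ?without" "I = Suc ` J" using V yes I by auto
      with I sink show "\<exists>J. I = Suc ` J \<and> flip_sink ?without J" by blast
    next
      assume "\<exists>J. I = Suc ` J \<and> flip_sink ?without J"
      then obtain J where J: "I = Suc ` J" "flip_sink ?without J" by blast
      then have "J \<in> ?without" by (simp add: flip_sink_def)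
      with J sink show "flip_sink ?V I" by blast
    qed
    also have "\<dots> \<longleftrightarrow> I = left_greedy (s # Q) w"
      using Cons.IH[OF Q _ ne] s w True by auto
    finally show ?thesis .
  next
    case False
    let ?containing = "facet_set Q w"
    let ?V = "facet_set (s # Q) w"
    have V: "?V = (\<lambda>I. insert 1 (Suc ` I)) ` ?containing"
      using False facets_Cons[OF s(1) w, of Q] by simp
    have ne: "?containing \<noteq> {}" using V Cons.prems(3) by simp
    have "increasing_flip (insert 1 (Suc ` J)) (insert 1 (Suc ` K)) \<longleftrightarrow> increasing_flip J K"
      if "J \<in> ?containing" "K \<in> ?containing" for J K
      using nz that increasing_flip_insert[of 1 "Suc ` J" "Suc ` K"]
      by (auto simp: increasing_flip_image_Suc)
    then have "flip_sink ?V I \<longleftrightarrow> (\<exists>J. I = insert 1 (Suc ` J) \<and> flip_sink ?containing J)"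
      unfolding flip_sink_def V by auto
    also have "\<dots> \<longleftrightarrow> I = left_greedy (s # Q) w"
      using Cons.IH[OF Q w ne] False by auto
    finally show ?thesis .
  qed
qed

lemma left_greedy_facet:
  "Q \<in> lists S \<Longrightarrow> w \<in> carrier W \<Longrightarrow> facet_set Q w \<noteq> {} \<Longrightarrow> left_greedy Q w \<in> facet_set Q w"
  using flip_sink_iff_left_greedy by (auto simp: flip_sink_def)

text \<open>
  As long as the first letter is a left descent of both of \<open>w\<close> and \<open>w q\<close> or of neither, the
  two greedy runs agree. It cannot be a descent of \<open>w\<close> alone, for reasons of length. When it is a
  descent of \<open>w q\<close> alone, the run for \<open>w q\<close> uses it and arrives at \<open>w\<close> by \<open>lifting\<close>, while the
  run for \<open>w\<close> skips it and stays at \<open>w\<close>; that is the position \<open>i\<close>. Such a letter must come, since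
  otherwise the two runs would end at \<open>q\<close> and at the identity respectively, whereas both have to
  end at the identity.
\<close>

theorem left_greedy_mult_right:
  assumes "Q \<in> lists S" "w \<in> carrier W" "q \<in> S" "len w < len (w \<otimes> q)"
    and "facet_set Q w \<noteq> {}" "facet_set Q (w \<otimes> q) \<noteq> {}"
  shows "\<exists>i \<in> left_greedy Q w. left_greedy Q (w \<otimes> q) = left_greedy Q w - {i}"
  using assms
proof (induction Q arbitrary: w rule: list.induct)
  case Nil
  then have "w = \<one>" "w \<otimes> q = \<one>"
    using generator_closed[OF \<open>q \<in> S\<close>] by (auto simp: facets_Nil split: if_splits)
  with Nil show ?case by simp
next
  case (Cons s Q)
  then have s: "s \<in> S" "s \<in> carrier W" "q \<in> carrier W" and Q: "Q \<in> lists S"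
    by (auto simp: generator_closed)
  note w = Cons.prems(2)
  have wq: "w \<otimes> q \<in> carrier W" using w s by simp
  have assoc: "s \<otimes> (w \<otimes> q) = s \<otimes> w \<otimes> q" using w s by (simp add: m_assoc)
  show ?case
  proof (cases "len (s \<otimes> w) < len w")
    case True
    have "len (s \<otimes> w \<otimes> q) \<le> Suc (len (s \<otimes> w))"
      using length_mult_right_le[of q "s \<otimes> w"] w s Cons.prems(3) by simp
    then have less: "len (s \<otimes> (w \<otimes> q)) < len (w \<otimes> q)"
      using length_descent[OF s(1) w True] Cons.prems(4) assoc by simp
    have "len (s \<otimes> w) < len (s \<otimes> w \<otimes> q)"
      using length_descent[OF s(1) w True] length_descent[OF s(1) wq less] Cons.prems(4) assoc by simp
    moreover have "facet_set Q (s \<otimes> w) \<noteq> {}" "facet_set Q (s \<otimes> w \<otimes> q) \<noteq> {}"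
      using facets_descent_nonempty[OF s(1) w True] facets_descent_nonempty[OF s(1) wq less]
        Cons.prems(5,6) assoc by auto
    ultimately obtain i where "i \<in> left_greedy Q (s \<otimes> w)"
      "left_greedy Q (s \<otimes> w \<otimes> q) = left_greedy Q (s \<otimes> w) - {i}"
      using Cons.IH[OF Q _ Cons.prems(3), of "s \<otimes> w"] s w by auto
    then show ?thesis
      using True less assoc by (intro bexI[of _ "Suc i"]) auto
  next
    case False
    have neQ: "facet_set Q w \<noteq> {}" using Cons.prems(5) False facets_Cons[OF s(1) w, of Q] by auto
    have bounds: "left_greedy Q w \<subseteq> positions Q"
      using left_greedy_facet[OF Q w neQ] facet_subset by blast
    then have nz: "0 \<notin> left_greedy Q w" using positions_bounds by blast
    show ?thesis
    proof (cases "len (s \<otimes> (w \<otimes> q)) < len (w \<otimes> q)")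
      case True
      have "len w < len (s \<otimes> w)" using False length_mult_neq[OF s(1) w] by simp
      then have "s \<otimes> (w \<otimes> q) = w"
        using lifting[OF s(1) Cons.prems(3) w] True by blast
      then show ?thesis
        using True False nz by (intro bexI[of _ 1]) auto
    next
      case notq: False
      then have "facet_set Q (w \<otimes> q) \<noteq> {}" using Cons.prems(6) facets_Cons[OF s(1) wq, of Q] by auto
      then obtain i where "i \<in> left_greedy Q w" "left_greedy Q (w \<otimes> q) = left_greedy Q w - {i}"
        using Cons.IH[OF Q w Cons.prems(3,4) neQ] by auto
      then show ?thesis
        using False notq nz by (intro bexI[of _ "Suc i"]) auto
    qed
  qed
qed

lemma negative_greedy_facet_eq:
  assumes "Q \<in> lists S" "w \<in> carrier W" "facet_set Q w \<noteq> {}"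
  shows "negative_greedy_facet W S Q w = left_greedy Q w"
proof -
  have "(I \<in> facet_set Q w \<and> out_arcs (flip_graph W S Q w) I = {}) \<longleftrightarrow> flip_sink (facet_set Q w) I" for I
    by (auto simp: flip_sink_def flip_graph_def out_arcs_def)
  then show ?thesis
    using flip_sink_iff_left_greedy[OF assms] by (simp add: negative_greedy_facet_def)
qed

lemma left_greedy_snoc_forced:
  assumes "Q \<in> lists S" "q \<in> S" "w \<in> carrier W"
    and "facet_set Q w = {}" "facet_set (Q @ [q]) w \<noteq> {}"
  shows "left_greedy (Q @ [q]) w = left_greedy Q (w \<otimes> q)"
proof -
  have V: "facet_set (Q @ [q]) w = facet_set Q (w \<otimes> q)"
    using assms(4,5) facets_snoc[OF assms(2,3), of Q] by (auto split: if_splits)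
  have "Q @ [q] \<in> lists S" "w \<otimes> q \<in> carrier W" using assms(1-3) generator_closed by auto
  then show ?thesis
    using flip_sink_iff_left_greedy[of "Q @ [q]" w] flip_sink_iff_left_greedy[of Q "w \<otimes> q"] V assms
    by metis
qed

text \<open>
  A flip to a facet that still contains the last position is a flip for \<open>Q\<close>, and the last
  position itself cannot be flipped upwards.
\<close>

lemma left_greedy_snoc:
  assumes "Q \<in> lists S" "q \<in> S" "w \<in> carrier W" "facet_set Q w \<noteq> {}"
  shows "left_greedy (Q @ [q]) w = insert (Suc (length Q)) (left_greedy Q w)"
proof -
  let ?m = "Suc (length Q)" and ?L = "left_greedy Q w"
  have sink: "flip_sink (facet_set Q w) ?L"
    using flip_sink_iff_left_greedy assms(1,3,4) by blast
  have fresh: "?m \<notin> I" if "I \<in> facet_set Q v" for I v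
    using facet_subset[OF that] positions_bounds(2) by blast
  have mem: "insert ?m ?L \<in> facet_set (Q @ [q]) w"
    using sink facets_snoc[OF assms(2,3), of Q] by (auto simp: flip_sink_def)
  moreover have "\<not> increasing_flip (insert ?m ?L) J" if J: "J \<in> facet_set (Q @ [q]) w" for J
  proof
    assume flip: "increasing_flip (insert ?m ?L) J"
    show False
    proof (cases "?m \<in> J")
      case True
      then obtain J' where "J' \<in> facet_set Q w" "J = insert ?m J'"
        using J facets_snoc[OF assms(2,3), of Q] fresh by (auto split: if_splits)
      then show False
        using flip sink fresh increasing_flip_insert by (auto simp: flip_sink_def)
    next
      case False
      obtain K i j where K: "i < j" "insert ?m ?L = insert i K" "J = insert j K"
        using flip by (rule increasing_flipE)
      then have "i = ?m" using False by auto
      moreover have "j \<le> ?m" using facet_subset[OF J] K(3) by (auto simp: positions_def)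
      ultimately show False using K(1) by simp
    qed
  qed
  ultimately have "flip_sink (facet_set (Q @ [q]) w) (insert ?m ?L)" by (simp add: flip_sink_def)
  moreover have "Q @ [q] \<in> lists S" using assms(1,2) by simp
  ultimately show ?thesis
    using flip_sink_iff_left_greedy[OF _ assms(3)] mem by (metis empty_iff)
qed

text \<open>
  The joining arc of the negative greedy flip tree: the sink for \<open>w q\<close> is that for \<open>w\<close> with one
  position \<open>i\<close> added, and the flip exchanges \<open>i\<close> for the last position.
\<close>

lemma left_greedy_flip_last:
  assumes "Q \<in> lists S" "q \<in> S" "w \<in> carrier W" "len (w \<otimes> q) < len w"
    and "facet_set Q w \<noteq> {}" "facet_set Q (w \<otimes> q) \<noteq> {}"
  shows "increasing_flip (left_greedy Q (w \<otimes> q)) (insert (Suc (length Q)) (left_greedy Q w))"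
proof -
  have q: "q \<in> carrier W" "w \<otimes> q \<in> carrier W" "w \<otimes> q \<otimes> q = w"
    using assms(2,3) by (simp_all add: generator_closed generator_cancel_right)
  obtain i where i: "i \<in> left_greedy Q (w \<otimes> q)"
    "left_greedy Q w = left_greedy Q (w \<otimes> q) - {i}"
    using left_greedy_mult_right[of Q "w \<otimes> q" q] assms q by auto
  have "left_greedy Q (w \<otimes> q) \<subseteq> positions Q"
    using left_greedy_facet[OF assms(1) q(2) assms(6)] facet_subset by blast
  then have "increasing_flip (insert i (left_greedy Q w)) (insert (Suc (length Q)) (left_greedy Q w))"
    unfolding i(2) using i(1) by (intro increasing_flipI) (auto simp: positions_def)
  moreover have "insert i (left_greedy Q w) = left_greedy Q (w \<otimes> q)"
    unfolding i(2) using i(1) by blast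
  ultimately show ?thesis by simp
qed

end

section \<open>Reversing the word\<close>

definition mirror :: "nat \<Rightarrow> nat set \<Rightarrow> nat set" where
  "mirror n = image (\<lambda>i. Suc n - i)"

lemma mirror_mirror:
  assumes "I \<subseteq> {1..n}" shows "mirror n (mirror n I) = I"
proof -
  have "(\<lambda>i. Suc n - (Suc n - i)) ` I = (\<lambda>i. i) ` I"
    by (rule image_cong) (use assms in auto)
  then show ?thesis by (simp add: mirror_def image_image)
qed

lemma mirror_subset: "I \<subseteq> {1..n} \<Longrightarrow> mirror n I \<subseteq> {1..n}"
  unfolding mirror_def by (rule image_subsetI) (drule (1) subsetD, auto)

lemma mirror_Suc: "mirror (Suc n) (Suc ` I) = mirror n I"
  by (simp add: mirror_def image_image)

lemma mirror_Suc_shift: "I \<subseteq> {1..n} \<Longrightarrow> mirror (Suc n) I = Suc ` mirror n I"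
  unfolding mirror_def image_image by (intro image_cong) (auto simp: Suc_diff_le)

lemma mirror_insert_1: "mirror (Suc n) (insert 1 I) = insert (Suc n) (mirror (Suc n) I)"
  by (simp add: mirror_def)

lemma mirror_insert_last:
  "I \<subseteq> {1..n} \<Longrightarrow> mirror (Suc n) (insert (Suc n) I) = insert 1 (Suc ` mirror n I)"
  using mirror_Suc_shift[of I n] by (simp add: mirror_def)

text \<open>
  Reading positions backwards turns \<open>i < j\<close> around.
\<close>

lemma increasing_flip_mirror:
  assumes "I \<subseteq> {1..n}" "J \<subseteq> {1..n}"
  shows "increasing_flip (mirror n I) (mirror n J) \<longleftrightarrow> increasing_flip J I"
proof -
  have flip: "increasing_flip (mirror n I) (mirror n J)"
    if "increasing_flip J I" "I \<subseteq> {1..n}" "J \<subseteq> {1..n}" for I J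
  proof -
    obtain K i j where K: "i \<notin> K" "j \<notin> K" "i < j" "J = insert i K" "I = insert j K"
      using \<open>increasing_flip J I\<close> by (rule increasing_flipE)
    have "Suc n - i \<notin> mirror n K" "Suc n - j \<notin> mirror n K"
    proof -
      have "inj_on (\<lambda>i. Suc n - i) {1..n}" by (auto simp: inj_on_def)
      then show "Suc n - i \<notin> mirror n K" "Suc n - j \<notin> mirror n K"
        using K(1,2) that(2,3) unfolding K(4,5) mirror_def by (simp_all add: inj_on_image_mem_iff)
    qed
    moreover have "Suc n - j < Suc n - i" using K that(2,3) by auto
    ultimately have "increasing_flip (insert (Suc n - j) (mirror n K)) (insert (Suc n - i) (mirror n K))"
      by (intro increasing_flipI)
    then show ?thesis using K by (simp add: mirror_def)
  qed
  have "mirror n I \<subseteq> {1..n}" "mirror n J \<subseteq> {1..n}" using assms by (simp_all only: mirror_subset)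
  then show ?thesis
    using flip[OF _ assms] flip[where I = "mirror n J" and J = "mirror n I"]
    unfolding mirror_mirror[OF assms(1)] mirror_mirror[OF assms(2)] by blast
qed

definition flip_source :: "nat set set \<Rightarrow> nat set \<Rightarrow> bool" where
  "flip_source V I \<longleftrightarrow> I \<in> V \<and> (\<forall>J \<in> V. \<not> increasing_flip J I)"

lemma flip_source_mirror:
  assumes "\<And>I. I \<in> V \<Longrightarrow> I \<subseteq> {1..n}"
  shows "flip_source V I \<longleftrightarrow> I \<subseteq> {1..n} \<and> flip_sink (mirror n ` V) (mirror n I)"
proof -
  have "mirror n I \<in> mirror n ` V \<longleftrightarrow> I \<in> V" if "I \<subseteq> {1..n}"
    using that assms mirror_mirror by (metis imageE imageI)
  then show ?thesis
    using assms increasing_flip_mirror by (auto simp: flip_source_def flip_sink_def)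
qed

context coxeter_system
begin

lemma facets_mirror:
  assumes "Q \<in> lists S" "w \<in> carrier W"
  shows "facet_set (rev Q) (inv w) = mirror (length Q) ` facet_set Q w"
  using assms
proof (induction Q arbitrary: w)
  case Nil
  then show ?case by (auto simp: facets_Nil mirror_def)
next
  case (Cons q Q)
  then have q: "q \<in> S" "q \<in> carrier W" and Q: "Q \<in> lists S" by (auto simp: generator_closed)
  have "inv w \<otimes> q = inv (q \<otimes> w)"
    using q Cons.prems by (simp add: inv_mult_group generator_inv)
  then show ?case
    using Cons.IH[of "q \<otimes> w"] Cons.IH[of w] q Q Cons.prems
    by (auto simp: facets_snoc facets_Cons length_inv length_inv_mult image_Un image_image
        mirror_Suc mirror_insert_1[unfolded One_nat_def])
qed

text \<open>
  The positions skipped when the letters of \<open>Q\<close> are used for \<open>w\<close> as late as possible.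
\<close>

definition right_greedy :: "'a list \<Rightarrow> 'a \<Rightarrow> nat set" where
  "right_greedy Q w = mirror (length Q) (left_greedy (rev Q) (inv w))"

lemma flip_source_iff_right_greedy:
  assumes "Q \<in> lists S" "w \<in> carrier W" "facet_set Q w \<noteq> {}"
  shows "flip_source (facet_set Q w) I \<longleftrightarrow> I = right_greedy Q w"
proof -
  let ?n = "length Q" and ?L = "left_greedy (rev Q) (inv w)"
  have rev: "rev Q \<in> lists S" "inv w \<in> carrier W" "facet_set (rev Q) (inv w) \<noteq> {}"
    using assms facets_mirror[OF assms(1,2)] by auto
  have L: "?L \<subseteq> {1..?n}"
    using facet_subset[OF left_greedy_facet[OF rev]] by (simp add: positions_def)
  have "flip_source (facet_set Q w) I \<longleftrightarrow> I \<subseteq> {1..?n} \<and> mirror ?n I = ?L"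
    using flip_source_mirror[of "facet_set Q w" ?n I] facet_subset
      facets_mirror[OF assms(1,2)] flip_sink_iff_left_greedy[OF rev]
    by (auto simp: positions_def)
  also have "\<dots> \<longleftrightarrow> I = right_greedy Q w"
    using mirror_mirror mirror_subset L unfolding right_greedy_def by metis
  finally show ?thesis .
qed

lemma positive_greedy_facet_eq:
  assumes "Q \<in> lists S" "w \<in> carrier W" "facet_set Q w \<noteq> {}"
  shows "positive_greedy_facet W S Q w = right_greedy Q w"
proof -
  have "(I \<in> facet_set Q w \<and> in_arcs (flip_graph W S Q w) I = {}) \<longleftrightarrow> flip_source (facet_set Q w) I" for I
    by (auto simp: flip_source_def flip_graph_def in_arcs_def)
  then show ?thesis
    using flip_source_iff_right_greedy[OF assms] by (simp add: positive_greedy_facet_def)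
qed

lemma reversed_word:
  assumes "Q \<in> lists S" "q \<in> S" "w \<in> carrier W"
  shows "rev Q \<in> lists S" "inv w \<otimes> q = inv (q \<otimes> w)" "q \<otimes> w \<in> carrier W"
    and "facet_set (rev Q) (inv w) = {} \<longleftrightarrow> facet_set Q w = {}"
  using assms facets_mirror
  by (auto simp: generator_closed inv_mult_group generator_inv)

lemma left_greedy_rev_subset:
  assumes "Q \<in> lists S" "w \<in> carrier W" "facet_set Q w \<noteq> {}"
  shows "left_greedy (rev Q) (inv w) \<subseteq> {1..length Q}"
proof -
  have "rev Q \<in> lists S" "inv w \<in> carrier W" "facet_set (rev Q) (inv w) \<noteq> {}"
    using assms facets_mirror[OF assms(1,2)] by auto
  from facet_subset[OF left_greedy_facet[OF this]] show ?thesis by (simp add: positions_def)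
qed

lemma right_greedy_Cons_forced:
  assumes "Q \<in> lists S" "q \<in> S" "w \<in> carrier W"
    and "facet_set Q w = {}" "facet_set (q # Q) w \<noteq> {}"
  shows "right_greedy (q # Q) w = Suc ` right_greedy Q (q \<otimes> w)"
proof -
  note m = reversed_word[OF assms(1-3)]
  have "q # Q \<in> lists S" using assms(1,2) by simp
  from facets_mirror[OF this assms(3)] have "facet_set (rev Q @ [q]) (inv w) \<noteq> {}"
    using assms(5) by simp
  then have "left_greedy (rev Q @ [q]) (inv w) = left_greedy (rev Q) (inv (q \<otimes> w))"
    using left_greedy_snoc_forced[of "rev Q" q "inv w"] m assms by simp
  moreover have "facet_set Q (q \<otimes> w) \<noteq> {}"
    using assms(4,5) facets_Cons[OF assms(2,3), of Q] by (auto split: if_splits)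
  ultimately show ?thesis
    using mirror_Suc_shift left_greedy_rev_subset[OF assms(1) m(3)] by (simp add: right_greedy_def)
qed

lemma right_greedy_Cons:
  assumes "Q \<in> lists S" "q \<in> S" "w \<in> carrier W" "facet_set Q w \<noteq> {}"
  shows "right_greedy (q # Q) w = insert 1 (Suc ` right_greedy Q w)"
  using left_greedy_snoc[of "rev Q" q "inv w"] reversed_word[OF assms(1-3)] assms
    mirror_insert_last left_greedy_rev_subset[OF assms(1,3,4)]
  by (simp add: right_greedy_def)

text \<open>
  The joining arc of the positive greedy flip tree, as the mirror image of that of the negative one.
\<close>

lemma right_greedy_flip_first:
  assumes "Q \<in> lists S" "q \<in> S" "w \<in> carrier W" "len (q \<otimes> w) < len w"
    and "facet_set Q w \<noteq> {}" "facet_set Q (q \<otimes> w) \<noteq> {}"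
  shows "increasing_flip (insert 1 (Suc ` right_greedy Q w)) (Suc ` right_greedy Q (q \<otimes> w))"
proof -
  note m = reversed_word[OF assms(1-3)]
  let ?n = "length Q"
  let ?I = "left_greedy (rev Q) (inv (q \<otimes> w))" and ?J = "left_greedy (rev Q) (inv w)"
  have I: "?I \<subseteq> {1..?n}" and J: "?J \<subseteq> {1..?n}"
    using left_greedy_rev_subset assms m(3) by blast+
  have "facet_set (rev Q) (inv w \<otimes> q) \<noteq> {}"
    using reversed_word(4)[OF assms(1,2) m(3)] assms(6) m(2) by simp
  then have "increasing_flip ?I (insert (Suc ?n) ?J)"
    using left_greedy_flip_last[of "rev Q" q "inv w"] m assms length_inv_mult(1)
    by (simp add: length_inv)
  moreover have "?I \<subseteq> {1..Suc ?n}" "insert (Suc ?n) ?J \<subseteq> {1..Suc ?n}" using I J by auto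
  ultimately have "increasing_flip (mirror (Suc ?n) (insert (Suc ?n) ?J)) (mirror (Suc ?n) ?I)"
    by (simp only: increasing_flip_mirror)
  then show ?thesis
    by (simp only: mirror_insert_last[OF J] mirror_Suc_shift[OF I] right_greedy_def)
qed

end

section \<open>Rooted trees\<close>

definition in_tree :: "'c pair_pre_digraph \<Rightarrow> 'c \<Rightarrow> bool" where
  "in_tree T r \<longleftrightarrow> r \<in> pverts T \<and> parcs T \<subseteq> pverts T \<times> pverts T \<and> single_valued (parcs T) \<and>
     r \<notin> Domain (parcs T) \<and> (\<forall>v \<in> pverts T. (v, r) \<in> (parcs T)\<^sup>*)"

lemma in_tree_join:
  assumes "in_tree T r" "in_tree T' r'" "pverts T \<inter> pverts T' = {}"
  shows "in_tree (join_digraphs T T' (r, r')) r'"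
proof -
  let ?A = "insert (r, r') (parcs T \<union> parcs T')"
  have "single_valued ?A" "r' \<notin> Domain ?A"
    using assms unfolding in_tree_def single_valued_def by blast+
  moreover have "(v, r') \<in> ?A\<^sup>*" if "v \<in> pverts T'" for v
    using that assms(2) rtrancl_mono[of "parcs T'" ?A] unfolding in_tree_def by blast
  moreover have "(v, r') \<in> ?A\<^sup>*" if "v \<in> pverts T" for v
  proof -
    have "(v, r) \<in> ?A\<^sup>*"
      using that assms(1) rtrancl_mono[of "parcs T" ?A] unfolding in_tree_def by blast
    then show ?thesis by (rule rtrancl_into_rtrancl) simp
  qed
  moreover have "r' \<in> pverts T \<union> pverts T'" "?A \<subseteq> (pverts T \<union> pverts T') \<times> (pverts T \<union> pverts T')"
    using assms unfolding in_tree_def by auto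
  ultimately show ?thesis
    by (auto simp: in_tree_def join_digraphs_def)
qed

lemma in_tree_map:
  assumes "in_tree T r" "inj_on f (pverts T)"
  shows "in_tree (map_digraph f T) (f r)"
proof -
  have V: "parcs T \<subseteq> pverts T \<times> pverts T" "r \<in> pverts T" using assms(1) by (auto simp: in_tree_def)
  have "(f v, f w) \<in> (map_prod f f ` parcs T)\<^sup>*" if "(v, w) \<in> (parcs T)\<^sup>*" for v w
    using that by (induction) (auto intro: rtrancl_into_rtrancl)
  moreover have "single_valued (map_prod f f ` parcs T)"
  proof (rule single_valuedI)
    fix x y z assume "(x, y) \<in> map_prod f f ` parcs T" "(x, z) \<in> map_prod f f ` parcs T"
    then obtain a b a' c where *: "(a, b) \<in> parcs T" "(a', c) \<in> parcs T" "x = f a" "x = f a'"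
      "y = f b" "z = f c" by auto
    then have "a = a'" using assms(2) V by (meson SigmaD1 inj_onD subsetD)
    with * show "y = z" using assms(1) by (auto simp: in_tree_def single_valued_def)
  qed
  moreover have "f r \<notin> Domain (map_prod f f ` parcs T)"
  proof
    assume "f r \<in> Domain (map_prod f f ` parcs T)"
    then obtain a b where ab: "(a, b) \<in> parcs T" "f r = f a" by auto
    then have "a = r" using assms(2) V by (metis SigmaD1 inj_onD subsetD)
    with ab show False using assms(1) by (auto simp: in_tree_def)
  qed
  ultimately show ?thesis
    using assms(1) by (auto simp: in_tree_def map_digraph_def)
qed

lemma in_tree_reachable:
  assumes "in_tree T r" "v \<in> pverts T"
  shows "v \<rightarrow>\<^sup>*\<^bsub>T\<^esub> r"
  unfolding reachable_def
  by (rule rtrancl_consistent_rtrancl_on) (use assms in \<open>auto simp: in_tree_def\<close>)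

lemma parcs_mk_symmetric_pair: "parcs (mk_symmetric (with_proj T)) = parcs T \<union> (parcs T)\<inverse>"
  by (auto simp: mk_symmetric_def)

text \<open>
  The distance to the root decreases along every arc, since a shortest path to the root has to start
  with the only outgoing arc.
\<close>

lemma in_tree_depth:
  fixes T :: "'c pair_pre_digraph"
  assumes "in_tree T r"
  obtains d :: "'c \<Rightarrow> nat" where "\<And>u v. (u, v) \<in> parcs T \<Longrightarrow> d v < d u"
proof
  define d where "d v = (LEAST n. (v, r) \<in> parcs T ^^ n)" for v
  fix u v assume uv: "(u, v) \<in> parcs T"
  then have "u \<in> pverts T" "u \<noteq> r" using assms by (auto simp: in_tree_def)
  then have "\<exists>n. (u, r) \<in> parcs T ^^ n"
    using assms by (auto simp: in_tree_def rtrancl_power)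
  then have du: "(u, r) \<in> parcs T ^^ d u" unfolding d_def by (rule LeastI_ex)
  then obtain k where k: "d u = Suc k" using \<open>u \<noteq> r\<close> by (cases "d u") auto
  with du obtain w where "(u, w) \<in> parcs T" "(w, r) \<in> parcs T ^^ k"
    by (metis relpow_Suc_E2)
  then have "(v, r) \<in> parcs T ^^ k"
    using uv assms by (auto simp: in_tree_def single_valued_def)
  then have "d v \<le> k" unfolding d_def by (rule Least_le)
  with k show "d v < d u" by simp
qed

text \<open>
  The two neighbours of a deepest vertex of the cycle are distinct, as the cycle has length at least
  3. Depth decreases along arcs, so both edges leave this vertex, contradicting that it has at most
  one outgoing arc.
\<close>

lemma in_tree_no_undirected_cycle:
  fixes T :: "'c pair_pre_digraph"
  assumes "in_tree T r" "pre_digraph.cycle (mk_symmetric (with_proj T)) p" "3 \<le> length p"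
  shows False
proof -
  let ?G = "with_proj (mk_symmetric (with_proj T))"
  let ?n = "length p"
  obtain d :: "'c \<Rightarrow> nat" where d: "\<And>u v. (u, v) \<in> parcs T \<Longrightarrow> d v < d u"
    using in_tree_depth[OF assms(1)] by metis
  obtain u where u: "pre_digraph.awalk ?G u p u" "distinct (tl (pre_digraph.awalk_verts ?G u p))"
    and p: "p \<noteq> []"
    using assms(2) by (auto simp: pre_digraph.cycle_def)
  have arcs: "set p \<subseteq> parcs T \<union> (parcs T)\<inverse>" and cas: "pcas u p u"
    using u(1) by (auto simp: pre_digraph.awalk_def parcs_mk_symmetric_pair cas_with_proj_eq)
  have verts: "pawalk_verts x q = x # map snd q" if "pcas x q y" for x y and q :: "('c \<times> 'c) list"
    using that by (induction q arbitrary: x) auto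
  have dist: "distinct (map snd p)"
    using u(2) verts[OF cas] by (simp add: awalk_verts_with_proj_eq)
  have link: "fst (q ! i) = (if i = 0 then x else snd (q ! (i - 1)))" if "pcas x q y" "i < length q"
    for x y i and q :: "('c \<times> 'c) list"
    using that
  proof (induction q arbitrary: x i)
    case (Cons e q)
    then show ?case using Cons.IH[of "snd e" "i - 1"] by (cases i) (auto simp: nth_Cons')
  qed simp
  have end_vertex: "x = last (y # map snd q)" if "pcas y q x" for x y and q :: "('c \<times> 'c) list"
    using that by (induction q arbitrary: y) auto
  \<comment> \<open>Vertices of the cycle are indexed by all natural numbers, modulo its length.\<close>
  define a where "a i = snd (p ! (i mod ?n))" for i
  have n: "?n \<ge> 3" by fact
  have step: "(a i, a (Suc i)) \<in> parcs T \<union> (parcs T)\<inverse>" for i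
  proof -
    have lt: "Suc i mod ?n < ?n" using n by (intro mod_less_divisor) linarith
    have "fst (p ! (Suc i mod ?n)) = a i"
    proof (cases "Suc i mod ?n = 0")
      case True
      then have "i mod ?n = ?n - 1"
        using n by (metis Suc_pred' add_diff_cancel_left' length_greater_0_conv mod_Suc nat.distinct(1) p plus_1_eq_Suc)
      moreover have "u = snd (p ! (?n - 1))"
        using end_vertex[OF cas] p by (simp add: last_map last_conv_nth)
      ultimately show ?thesis
        using link[OF cas lt] True by (simp add: a_def)
    next
      case False
      then have "Suc i mod ?n - 1 = i mod ?n" by (simp add: mod_Suc split: if_splits)
      then show ?thesis
        using link[OF cas lt] False by (simp add: a_def)
    qed
    then have "p ! (Suc i mod ?n) = (a i, a (Suc i))" by (simp add: a_def prod_eq_iff)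
    then show ?thesis using arcs lt nth_mem by (metis subsetD)
  qed
  let ?D = "(\<lambda>i. d (a i)) ` {..<?n}"
  have "Max ?D \<in> ?D" using p by (intro Max_in) auto
  then obtain k where k: "k < ?n" "d (a k) = Max ?D" by auto
  have deepest: "d (a i) \<le> d (a k)" for i
    proof -
    have "d (a (i mod ?n)) \<le> Max ?D" using p by (intro Max_ge) auto
    then show ?thesis using k(2) by (simp add: a_def)
  qed
  have "Suc (k + ?n - 1) = k + ?n" using n by linarith
  then have ak: "a (Suc (k + ?n - 1)) = a k" by (simp add: a_def)
  \<comment> \<open>The predecessor of \<open>a k\<close> is written with index \<open>k + ?n - 1\<close>, as \<open>k\<close> may be 0.\<close>
  have "(a k, a (Suc k)) \<in> parcs T"
    using step[of k] deepest[of "Suc k"] d by fastforce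
  moreover have "(a k, a (k + ?n - 1)) \<in> parcs T"
    using step[of "k + ?n - 1"] deepest[of "k + ?n - 1"] d unfolding ak by fastforce
  ultimately have "a (Suc k) = a (k + ?n - 1)"
    using assms(1) by (auto simp: in_tree_def single_valued_def)
  then have "Suc k mod ?n = (k + ?n - 1) mod ?n"
    using dist n by (simp add: a_def distinct_conv_nth) (metis mod_less_divisor p length_greater_0_conv)
  moreover have "(k + ?n - 1) mod ?n = (if k = 0 then ?n - 1 else k - 1)"
  proof (cases k)
    case 0
    then show ?thesis using n by simp
  next
    case (Suc l)
    then show ?thesis using k(1) by simp
  qed
  moreover have "Suc k mod ?n = (if Suc k = ?n then 0 else Suc k)"
    using k(1) by (simp add: mod_Suc)
  ultimately show False
    using n by (auto split: if_splits)
qed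

lemma in_tree_oriented_tree:
  fixes T :: "'c pair_pre_digraph"
  assumes "in_tree T r" shows "oriented_tree T"
proof -
  have T: "parcs T \<subseteq> pverts T \<times> pverts T" "r \<in> pverts T" using assms by (auto simp: in_tree_def)
  interpret T: pair_wf_digraph T by unfold_locales (use T in auto)
  let ?M = "mk_symmetric (with_proj T)"
  interpret M: pair_wf_digraph ?M by (rule T.wellformed_mk_symmetric)
  have to_root: "v \<rightarrow>\<^sup>*\<^bsub>?M\<^esub> r" if "v \<in> pverts T" for v
    using in_tree_reachable[OF assms that] by (rule T.reachable_mk_symmetricI)
  then have "u \<rightarrow>\<^sup>*\<^bsub>?M\<^esub> v" if "u \<in> pverts T" "v \<in> pverts T" for u v
    using that symmetric_reachable[OF symmetric_mk_symmetric] M.reachable_trans by metis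
  then have "Digraph_Component.connected T"
    using T(2) by (auto simp: connected_def strongly_connected_def)
  moreover obtain d :: "'c \<Rightarrow> nat" where "\<And>u v. (u, v) \<in> parcs T \<Longrightarrow> d v < d u"
    using in_tree_depth[OF assms] by metis
  then have "\<forall>u v. (u, v) \<in> parcs T \<longrightarrow> (v, u) \<notin> parcs T" by (meson less_asym)
  ultimately show ?thesis
    using in_tree_no_undirected_cycle[OF assms] by (auto simp: oriented_tree_def)
qed

definition reverse_digraph :: "'c pair_pre_digraph \<Rightarrow> 'c pair_pre_digraph" where
  "reverse_digraph T = \<lparr>pverts = pverts T, parcs = (parcs T)\<inverse>\<rparr>"

text \<open>
  Transfers the results on trees flowing to a root to trees flowing from a root.
\<close>

lemma oriented_tree_reverse: "oriented_tree (reverse_digraph T) \<longleftrightarrow> oriented_tree T"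
proof -
  have "mk_symmetric (with_proj (reverse_digraph T)) = mk_symmetric (with_proj T)"
    by (auto simp: mk_symmetric_def reverse_digraph_def)
  then show ?thesis
    by (auto simp: oriented_tree_def connected_def) (auto simp: reverse_digraph_def)
qed

lemma reverse_join: "reverse_digraph (join_digraphs T T' (a, b)) =
    join_digraphs (reverse_digraph T) (reverse_digraph T') (b, a)"
  by (auto simp: reverse_digraph_def join_digraphs_def)

lemma reverse_map: "reverse_digraph (map_digraph f T) = map_digraph f (reverse_digraph T)"
  by (auto simp: reverse_digraph_def map_digraph_def)

lemma in_tree_oriented_towards: "in_tree T r \<Longrightarrow> oriented_towards T r"
  by (simp add: oriented_towards_def in_tree_reachable) (simp add: in_tree_def)

lemma in_tree_reverse_oriented_from:
  assumes "in_tree (reverse_digraph T) r" shows "oriented_from T r"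
proof -
  have "r \<rightarrow>\<^sup>*\<^bsub>T\<^esub> v" if "v \<in> pverts T" for v
    using in_tree_reachable[OF assms, of v] that rtrancl_on_converseI[of v r "pverts T" "(parcs T)\<inverse>"]
    by (simp add: reachable_def reverse_digraph_def)
  then show ?thesis
    using assms by (auto simp: oriented_from_def in_tree_def reverse_digraph_def)
qed

text \<open>
  The relation \<open>R\<close> is the increasing flip for the negative tree and its converse for the reversal of
  the positive tree.
\<close>

definition flip_tree ::
  "(nat set \<Rightarrow> nat set \<Rightarrow> bool) \<Rightarrow> nat set pair_pre_digraph \<Rightarrow> nat set set \<Rightarrow> nat set \<Rightarrow> bool" where
  "flip_tree R T V r \<longleftrightarrow> pverts T = V \<and> in_tree T r \<and> (\<forall>(I, J) \<in> parcs T. R I J)"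

lemma flip_tree_map:
  assumes "flip_tree R T V r" "inj_on f V"
    and "\<And>I J. I \<in> V \<Longrightarrow> J \<in> V \<Longrightarrow> R I J \<Longrightarrow> R (f I) (f J)"
  shows "flip_tree R (map_digraph f T) (f ` V) (f r)"
proof -
  have T: "pverts T = V" "in_tree T r" using assms(1) by (simp_all add: flip_tree_def)
  then have "in_tree (map_digraph f T) (f r)" using assms(2) by (intro in_tree_map) simp_all
  moreover have "parcs T \<subseteq> V \<times> V" using T by (simp add: in_tree_def)
  ultimately show ?thesis
    using assms(1,3) by (fastforce simp: flip_tree_def map_digraph_def)
qed

lemma flip_tree_join:
  assumes "flip_tree R T V r" "flip_tree R T' V' r'" "V \<inter> V' = {}" "R r r'"
  shows "flip_tree R (join_digraphs T T' (r, r')) (V \<union> V') r'"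
  using assms in_tree_join[of T r T' r'] by (auto simp: flip_tree_def join_digraphs_def)

section \<open>The greedy flip trees\<close>

context coxeter_system
begin

theorem negative_greedy_tree_in_tree:
  assumes "Q \<in> lists S" "w \<in> carrier W" "facet_set Q w \<noteq> {}"
  shows "flip_tree increasing_flip (negative_greedy_tree W S Q w) (facet_set Q w) (left_greedy Q w)"
  using assms
proof (induction Q arbitrary: w rule: rev_induct)
  case Nil
  then show ?case
    by (auto simp: facets_Nil flip_tree_def in_tree_def base_tree_def split: if_splits)
next
  case (snoc q Q)
  note w = snoc.prems(2)
  have q: "q \<in> S" "q \<in> carrier W" and Q: "Q \<in> lists S" and wq: "w \<otimes> q \<in> carrier W"
    using snoc.prems generator_closed by auto
  let ?m = "Suc (length Q)"
  let ?F = "facet_set (Q @ [q]) w" and ?without = "facet_set Q (w \<otimes> q)" and ?containing = "facet_set Q w"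
  let ?T = "negative_greedy_tree W S Q (w \<otimes> q)" and ?U = "star_tree ?m (negative_greedy_tree W S Q w)"
  have F: "?F = (if len (w \<otimes> q) < len w then ?without else {}) \<union> insert ?m ` ?containing"
    by (rule facets_snoc[OF q(1) w])
  have fresh: "?m \<notin> I" if "I \<in> facet_set Q v" for I v
    using facet_subset[OF that] positions_bounds(2) by blast
  have U: "flip_tree increasing_flip ?U (insert ?m ` ?containing) (insert ?m (left_greedy Q w))"
    if "?containing \<noteq> {}"
  proof (rule flip_tree_map)
    show "flip_tree increasing_flip (negative_greedy_tree W S Q w) ?containing (left_greedy Q w)"
      using snoc.IH[OF Q w that] .
    show "inj_on (insert ?m) ?containing"
      using fresh by (intro inj_onI) (simp add: insert_ident)
    show "increasing_flip (insert ?m I) (insert ?m J)"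
      if "I \<in> ?containing" "J \<in> ?containing" "increasing_flip I J" for I J
      using that fresh by (simp add: increasing_flip_insert)
  qed
  consider (absent) "\<forall>I \<in> ?F. ?m \<notin> I" | (always) "\<forall>I \<in> ?F. ?m \<in> I" "\<not> (\<forall>I \<in> ?F. ?m \<notin> I)"
    | (mixed) "\<not> (\<forall>I \<in> ?F. ?m \<notin> I)" "\<not> (\<forall>I \<in> ?F. ?m \<in> I)" by blast
  then show ?case
  proof cases
    case absent
    then have containing: "?containing = {}" using F by auto
    then have F': "?F = ?without" using F snoc.prems(3) by (simp split: if_splits)
    have tree: "negative_greedy_tree W S (Q @ [q]) w = ?T"
      using absent by (simp add: Let_def)
    have "?without \<noteq> {}" using snoc.prems(3) unfolding F' .
    from snoc.IH[OF Q wq this] show ?thesis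
      unfolding F' tree left_greedy_snoc_forced[OF Q q(1) w containing snoc.prems(3)] .
  next
    case always
    have "?without = {}" if "len (w \<otimes> q) < len w"
    proof (rule equals0I)
      fix I assume I: "I \<in> ?without"
      then have "I \<in> ?F" using F that by simp
      then show False using always(1) fresh[OF I] by blast
    qed
    then have F': "?F = insert ?m ` ?containing" using F by simp
    have tree: "negative_greedy_tree W S (Q @ [q]) w = ?U"
      using always by (simp add: Let_def)
    have containing: "?containing \<noteq> {}" using F' snoc.prems(3) by auto
    from U[OF this] show ?thesis
      unfolding F' tree left_greedy_snoc[OF Q q(1) w containing] .
  next
    case mixed
    obtain I J where I: "I \<in> ?F" "?m \<in> I" and J: "J \<in> ?F" "?m \<notin> J"
      using mixed by blast
    have J': "J \<in> (if len (w \<otimes> q) < len w then ?without else {})" using J unfolding F by blast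
    then have less: "len (w \<otimes> q) < len w" by (metis empty_iff)
    with J' have without: "?without \<noteq> {}" by auto
    have "I \<notin> ?without" using I(2) fresh by blast
    then have containing: "?containing \<noteq> {}" using I(1) F by (auto split: if_splits)
    have F': "?F = ?without \<union> insert ?m ` ?containing" using F less by simp
    have tree: "negative_greedy_tree W S (Q @ [q]) w =
        join_digraphs ?T ?U (left_greedy Q (w \<otimes> q), left_greedy (Q @ [q]) w)"
      by (simp only: negative_greedy_tree.simps Let_def length_append_singleton mixed if_False
          negative_greedy_facet_eq[OF Q wq without] negative_greedy_facet_eq[OF snoc.prems])
    show ?thesis
      unfolding F' tree left_greedy_snoc[OF Q q(1) w containing]
      using snoc.IH[OF Q wq without] U[OF containing] _
        left_greedy_flip_last[OF Q q(1) w less containing without]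
      by (rule flip_tree_join) (use fresh in auto)
  qed
qed

theorem positive_greedy_tree_in_tree:
  assumes "Q \<in> lists S" "w \<in> carrier W" "facet_set Q w \<noteq> {}"
  shows "flip_tree (\<lambda>I J. increasing_flip J I) (reverse_digraph (positive_greedy_tree W S Q w))
    (facet_set Q w) (right_greedy Q w)"
  using assms
proof (induction Q arbitrary: w rule: list.induct)
  case Nil
  then show ?case
    by (auto simp: facets_Nil flip_tree_def in_tree_def base_tree_def reverse_digraph_def
        right_greedy_def mirror_def split: if_splits)
next
  case (Cons q Q)
  note w = Cons.prems(2)
  have q: "q \<in> S" "q \<in> carrier W" and Q: "Q \<in> lists S" and qw: "q \<otimes> w \<in> carrier W"
    using Cons.prems generator_closed by auto
  let ?R = "\<lambda>I J. increasing_flip J I"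
  let ?F = "facet_set (q # Q) w" and ?without = "facet_set Q (q \<otimes> w)" and ?containing = "facet_set Q w"
  let ?T = "shift_tree (positive_greedy_tree W S Q (q \<otimes> w))"
  let ?U = "star_tree 1 (shift_tree (positive_greedy_tree W S Q w))"
  have F: "?F = (if len (q \<otimes> w) < len w then image Suc ` ?without else {}) \<union>
      (\<lambda>I. insert 1 (Suc ` I)) ` ?containing"
    by (rule facets_Cons[OF q(1) w])
  have fresh: "1 \<notin> Suc ` I" if "I \<in> facet_set Q v" for I v
    using facet_subset[OF that] positions_bounds(1) by auto
  have shift: "flip_tree ?R (reverse_digraph (shift_tree (positive_greedy_tree W S Q v)))
      (image Suc ` facet_set Q v) (Suc ` right_greedy Q v)"
    if "v \<in> carrier W" "facet_set Q v \<noteq> {}" for v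
    unfolding reverse_map using Cons.IH[OF Q that]
    by (rule flip_tree_map) (auto simp: increasing_flip_image_Suc inj_on_def inj_image_eq_iff)
  have U: "flip_tree ?R (reverse_digraph ?U) ((\<lambda>I. insert 1 (Suc ` I)) ` ?containing)
      (insert 1 (Suc ` right_greedy Q w))" if "?containing \<noteq> {}"
  proof -
    have "flip_tree ?R (star_tree 1 (reverse_digraph (shift_tree (positive_greedy_tree W S Q w))))
        (insert 1 ` image Suc ` ?containing) (insert 1 (Suc ` right_greedy Q w))"
    proof (rule flip_tree_map[OF shift[OF w that]])
      have avoid: "1 \<notin> I" if "I \<in> image Suc ` ?containing" for I
        using that fresh by blast
      show "inj_on (insert 1) (image Suc ` ?containing)"
        using avoid by (intro inj_onI) (simp add: insert_ident)
      show "increasing_flip (insert 1 J) (insert 1 I)"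
        if "I \<in> image Suc ` ?containing" "J \<in> image Suc ` ?containing" "increasing_flip J I" for I J
        using that avoid by (simp add: increasing_flip_insert)
    qed
    then show ?thesis by (simp add: reverse_map image_image)
  qed
  consider (absent) "\<forall>I \<in> ?F. 1 \<notin> I" | (always) "\<forall>I \<in> ?F. 1 \<in> I" "\<not> (\<forall>I \<in> ?F. 1 \<notin> I)"
    | (mixed) "\<not> (\<forall>I \<in> ?F. 1 \<notin> I)" "\<not> (\<forall>I \<in> ?F. 1 \<in> I)" by blast
  then show ?case
  proof cases
    case absent
    then have containing: "?containing = {}" using F by auto
    then have F': "?F = image Suc ` ?without"
      using F Cons.prems(3) by (simp split: if_splits)
    have tree: "positive_greedy_tree W S (q # Q) w = ?T"
      using absent by (simp add: Let_def)
    have "?without \<noteq> {}" using Cons.prems(3) unfolding F' by simp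
    from shift[OF qw this] show ?thesis
      unfolding F' tree right_greedy_Cons_forced[OF Q q(1) w containing Cons.prems(3)] .
  next
    case always
    have "?without = {}" if "len (q \<otimes> w) < len w"
    proof (rule equals0I)
      fix I assume I: "I \<in> ?without"
      then have "Suc ` I \<in> ?F" using F that by simp
      then show False using always(1) fresh[OF I] by blast
    qed
    then have F': "?F = (\<lambda>I. insert 1 (Suc ` I)) ` ?containing" using F by simp
    have tree: "positive_greedy_tree W S (q # Q) w = ?U"
      using always by (simp add: Let_def)
    have containing: "?containing \<noteq> {}" using F' Cons.prems(3) by auto
    from U[OF this] show ?thesis
      unfolding F' tree right_greedy_Cons[OF Q q(1) w containing] .
  next
    case mixed
    obtain I J where I: "I \<in> ?F" "1 \<in> I" and J: "J \<in> ?F" "1 \<notin> J"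
      using mixed by blast
    have J': "J \<in> (if len (q \<otimes> w) < len w then image Suc ` ?without else {})" using J unfolding F by blast
    then have less: "len (q \<otimes> w) < len w" by (metis empty_iff)
    with J' have without: "?without \<noteq> {}" by auto
    have "I \<notin> image Suc ` ?without" using I(2) fresh by blast
    then have containing: "?containing \<noteq> {}" using I(1) F by (auto split: if_splits)
    have F': "?F = image Suc ` ?without \<union> (\<lambda>I. insert 1 (Suc ` I)) ` ?containing"
      using F less by simp
    have tree: "positive_greedy_tree W S (q # Q) w =
        join_digraphs ?T ?U (right_greedy (q # Q) w, Suc ` right_greedy Q (q \<otimes> w))"
      by (simp only: positive_greedy_tree.simps Let_def mixed if_False
          positive_greedy_facet_eq[OF Q qw without] positive_greedy_facet_eq[OF Cons.prems])
    show ?thesis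
      unfolding F' tree reverse_join right_greedy_Cons[OF Q q(1) w containing]
      using shift[OF qw without] U[OF containing] _
        right_greedy_flip_first[OF Q q(1) w less containing without]
    proof (rule flip_tree_join)
      have "1 \<notin> G" if "G \<in> image Suc ` ?without" for G
        using that fresh by blast
      then show "image Suc ` ?without \<inter> (\<lambda>I. insert 1 (Suc ` I)) ` ?containing = {}"
        by blast
    qed
  qed
qed

end

lemma spanning_flip_graph:
  fixes T :: "nat set pair_pre_digraph"
  assumes "pverts T = facets W S Q \<rho>" "parcs T \<subseteq> pverts T \<times> pverts T"
    and "\<forall>(I, J) \<in> parcs T. increasing_flip I J"
  shows "spanning T (flip_graph W S Q \<rho>)"
proof -
  have "wf_digraph T"
    using assms(2) by unfold_locales auto
  moreover have "wf_digraph (flip_graph W S Q \<rho>)"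
    by unfold_locales (auto simp: flip_graph_def)
  ultimately show ?thesis
    using assms by (auto simp: spanning_def subgraph_def compatible_def flip_graph_def)
qed

theorem lemma3p7:
  fixes W :: "('a, 'b) monoid_scheme" and S :: "'a set" and Q :: "'a list" and \<rho> :: 'a
  assumes "coxeter_system W S" and "finite (carrier W)"
    and "Q \<in> lists S" and "\<rho> \<in> carrier W" and "contains_reduced W S Q \<rho>"
  shows "(oriented_spanning_tree (negative_greedy_tree W S Q \<rho>) (flip_graph W S Q \<rho>) \<and>
          oriented_towards (negative_greedy_tree W S Q \<rho>) (negative_greedy_facet W S Q \<rho>)) \<and>
         (oriented_spanning_tree (positive_greedy_tree W S Q \<rho>) (flip_graph W S Q \<rho>) \<and>
          oriented_from (positive_greedy_tree W S Q \<rho>) (positive_greedy_facet W S Q \<rho>))"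
proof -
  interpret coxeter_system W S by fact
  let ?N = "negative_greedy_tree W S Q \<rho>" and ?P = "positive_greedy_tree W S Q \<rho>"
  have ne: "facet_set Q \<rho> \<noteq> {}" using facets_nonempty assms(5) .
  note Q = assms(3,4) ne
  have N: "pverts ?N = facet_set Q \<rho>" "in_tree ?N (negative_greedy_facet W S Q \<rho>)"
    "\<forall>(I, J) \<in> parcs ?N. increasing_flip I J"
    using negative_greedy_tree_in_tree[OF Q] negative_greedy_facet_eq[OF Q]
    by (simp_all add: flip_tree_def)
  have P: "pverts ?P = facet_set Q \<rho>" "in_tree (reverse_digraph ?P) (positive_greedy_facet W S Q \<rho>)"
    "\<forall>(I, J) \<in> parcs ?P. increasing_flip I J"
    using positive_greedy_tree_in_tree[OF Q] positive_greedy_facet_eq[OF Q]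
    by (auto simp: flip_tree_def reverse_digraph_def)
  have "oriented_tree ?N" "oriented_tree ?P"
    using in_tree_oriented_tree[OF N(2)] in_tree_oriented_tree[OF P(2)]
    by (simp_all add: oriented_tree_reverse)
  moreover have "spanning ?N (flip_graph W S Q \<rho>)"
    using N by (intro spanning_flip_graph) (auto simp: in_tree_def)
  moreover have "spanning ?P (flip_graph W S Q \<rho>)"
    using P by (intro spanning_flip_graph) (auto simp: in_tree_def reverse_digraph_def)
  ultimately show ?thesis
    using in_tree_oriented_towards[OF N(2)] in_tree_reverse_oriented_from[OF P(2)]
    by (simp add: oriented_spanning_tree_def)
qed

end
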